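(* Let $K=\mathbb C^n$ and let $T=\begin{bmatrix} BU & CV\\ C^*U & EV\end{bmatrix}\in\mathcal G$. Then $T$ is non-unitary normal (that is, normal and not unitary as an operator on the Hilbert space $H\oplus\mathbb C^n$) if and only if for every $i\in\{1,\dots,l\}$ $$U(M_i)=M_i,\qquad V(K_i)=K_i,\qquad [U\restriction_{M_i}]_{\beta_i'}=[V\restriction_{K_i}]_{\beta_i},$$ where $[\,\cdot\,]_{\beta}$ denotes the matrix of a linear operator with respect to the ordered basis $\beta$.
   Context: $H$ is a complex Hilbert space and $K=\mathbb C^n$; $H$ and $K$ have different (Hilbert) dimensions. $B(K,H)$ is the Banach space of bounded linear operators $K\to H$ with the operator norm, $\mathcal B$ is its open unit ball, and $U(H)$, $U(K)$ are the unitary groups. $\mathcal G$ is the group of all bijective linear operators on $H\oplus K$ that leave invariant the Hermitian form $\mathcal S((h_1,k_1),(h_2,k_2))=\langle h_1,h_2\rangle-\langle k_1,k_2\rangle$. Every $T\in\mathcal G$ is written as $T=\begin{bmatrix} BU & CV\\ C^*U & EV\end{bmatrix}$ with $U\in U(H)$, $V\in U(K)$, $B=(I-AA^* )^{-1/2}$, $C=(I-AA^* )^{-1/2}A$, $E=(I-A^*A)^{-1/2}$ for some $A\in\mathcal B$. Notation attached to $T$: $a_1,\dots,a_l$ are the distinct eigenvalues of $E$ that are $>1$, $K_i=\ker(E-a_iI)$, $K'=\bigoplus_{i=1}^l K_i$ (so $E=I$ and $C=0$ on $K'^\perp$), $k_i=\dim K_i$. $\beta_i=\{e_{i_j}: j=1,\dots,k_i\}$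 is a fixed orthonormal basis of $K_i$, $\xi_{i_j}=C(e_{i_j})$ (these are non-zero, mutually orthogonal vectors of $H$), $\|\xi_{i_j}\|=\delta_i$ with $a_i^2=1+\delta_i^2$, $M_i=\operatorname{span}\{\xi_{i_j}: j=1,\dots,k_i\}$, and $\beta_i'=\{\xi_{i_j}: j=1,\dots,k_i\}$ is the corresponding orthogonal basis of $M_i$. One has $\operatorname{ran}C=\bigoplus_{i=1}^l M_i$, $B=a_iI$ on $M_i$ and $B=I$ on $(\operatorname{ran}C)^\perp$.
   Formalization: The formal theorem assumes l ≥ 1 (E has at least one eigenvalue greater than 1); for l = 0, i.e. A = 0, e.g. T = I, T is unitary while the condition over i holds vacuously, so the equivalence as stated fails there. *)

theory Defs
  imports "HOL-Analysis.Analysis" "HOL-Library.Equipollence"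
begin

text \<open>Complex inner product spaces; the inner product is linear in its first argument.\<close>

class complex_inner = real_normed_vector +
  fixes scaleC :: "complex \<Rightarrow> 'a \<Rightarrow> 'a"  (infixr \<open>*\<^sub>C\<close> 75)
    and cinner :: "'a \<Rightarrow> 'a \<Rightarrow> complex"
  assumes scaleC_add_right: "c *\<^sub>C (x + y) = c *\<^sub>C x + c *\<^sub>C y"
    and scaleC_add_left: "(c + d) *\<^sub>C x = c *\<^sub>C x + d *\<^sub>C x"
    and scaleC_scaleC: "c *\<^sub>C (d *\<^sub>C x) = (c * d) *\<^sub>C x"
    and scaleR_scaleC: "r *\<^sub>R x = complex_of_real r *\<^sub>C x"
    and cinner_commute: "cinner x y = cnj (cinner y x)"
    and cinner_add_left: "cinner (x + y) z = cinner x z + cinner y z"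
    and cinner_scaleC_left: "cinner (c *\<^sub>C x) y = c * cinner x y"
    and cinner_self: "cinner x x = complex_of_real ((norm x)\<^sup>2)"

class chilbert_space = complex_inner + complete_space

instantiation complex :: chilbert_space
begin

definition scaleC_complex :: "complex \<Rightarrow> complex \<Rightarrow> complex" where
  "scaleC_complex c x = c * x"

definition cinner_complex :: "complex \<Rightarrow> complex \<Rightarrow> complex" where
  "cinner_complex x y = x * cnj y"

instance
proof
  fix x y z c d :: complex and r :: real
  show "c *\<^sub>C (x + y) = c *\<^sub>C x + c *\<^sub>C y"
    and "(c + d) *\<^sub>C x = c *\<^sub>C x + d *\<^sub>C x"
    and "c *\<^sub>C (d *\<^sub>C x) = (c * d) *\<^sub>C x"
    and "r *\<^sub>R x = complex_of_real r *\<^sub>C x"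
    by (simp_all add: scaleC_complex_def distrib_left distrib_right scaleR_conv_of_real)
  show "cinner x y = cnj (cinner y x)"
    and "cinner (x + y) z = cinner x z + cinner y z"
    and "cinner (c *\<^sub>C x) y = c * cinner x y"
    by (simp_all add: scaleC_complex_def cinner_complex_def distrib_right)
  show "cinner x x = complex_of_real ((norm x)\<^sup>2)"
    unfolding cinner_complex_def by (rule complex_norm_square[symmetric])
qed

end

instantiation vec :: (complex_inner, finite) complex_inner
begin

definition scaleC_vec :: "complex \<Rightarrow> 'a ^ 'b \<Rightarrow> 'a ^ 'b" where
  "scaleC_vec c x = (\<chi> i. c *\<^sub>C (x $ i))"

definition cinner_vec :: "'a ^ 'b \<Rightarrow> 'a ^ 'b \<Rightarrow> complex" where
  "cinner_vec x y = (\<Sum>i\<in>UNIV. cinner (x $ i) (y $ i))"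

instance
proof
  fix x y z :: "'a ^ 'b" and c d :: complex and r :: real
  show "c *\<^sub>C (x + y) = c *\<^sub>C x + c *\<^sub>C y"
    and "(c + d) *\<^sub>C x = c *\<^sub>C x + d *\<^sub>C x"
    and "c *\<^sub>C (d *\<^sub>C x) = (c * d) *\<^sub>C x"
    and "r *\<^sub>R x = complex_of_real r *\<^sub>C x"
    by (simp_all add: scaleC_vec_def vec_eq_iff scaleC_add_right scaleC_add_left scaleC_scaleC
        scaleR_scaleC)
  show "cinner x y = cnj (cinner y x)"
    unfolding cinner_vec_def cnj_sum by (rule sum.cong[OF refl]) (rule cinner_commute)
  show "cinner (x + y) z = cinner x z + cinner y z"
    by (simp add: cinner_vec_def cinner_add_left sum.distrib)
  show "cinner (c *\<^sub>C x) y = c * cinner x y"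
    by (simp add: cinner_vec_def scaleC_vec_def cinner_scaleC_left sum_distrib_left)
  show "cinner x x = complex_of_real ((norm x)\<^sup>2)"
    by (simp add: cinner_vec_def cinner_self norm_vec_def L2_set_def sum_nonneg)
qed

end

instance vec :: (chilbert_space, finite) chilbert_space ..

instantiation prod :: (complex_inner, complex_inner) complex_inner
begin

definition scaleC_prod :: "complex \<Rightarrow> 'a \<times> 'b \<Rightarrow> 'a \<times> 'b" where
  "scaleC_prod c x = (c *\<^sub>C fst x, c *\<^sub>C snd x)"

definition cinner_prod :: "'a \<times> 'b \<Rightarrow> 'a \<times> 'b \<Rightarrow> complex" where
  "cinner_prod x y = cinner (fst x) (fst y) + cinner (snd x) (snd y)"

instance
proof
  fix x y z :: "'a \<times> 'b" and c d :: complex and r :: real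
  show "c *\<^sub>C (x + y) = c *\<^sub>C x + c *\<^sub>C y"
    and "(c + d) *\<^sub>C x = c *\<^sub>C x + d *\<^sub>C x"
    and "c *\<^sub>C (d *\<^sub>C x) = (c * d) *\<^sub>C x"
    and "r *\<^sub>R x = complex_of_real r *\<^sub>C x"
    by (simp_all add: scaleC_prod_def prod_eq_iff scaleC_add_right scaleC_add_left scaleC_scaleC
        scaleR_scaleC)
  show "cinner x y = cnj (cinner y x)"
    using cinner_commute[of "fst x" "fst y"] cinner_commute[of "snd x" "snd y"]
    by (simp only: cinner_prod_def complex_cnj_add)
  show "cinner (x + y) z = cinner x z + cinner y z"
    by (simp add: cinner_prod_def cinner_add_left)
  show "cinner (c *\<^sub>C x) y = c * cinner x y"
    by (simp add: cinner_prod_def scaleC_prod_def cinner_scaleC_left distrib_left)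
  show "cinner x x = complex_of_real ((norm x)\<^sup>2)"
    by (simp add: cinner_prod_def cinner_self norm_prod_def)
qed

end

instance prod :: (chilbert_space, chilbert_space) chilbert_space ..

interpretation cvs: vector_space "scaleC :: complex \<Rightarrow> 'a \<Rightarrow> 'a::complex_inner"
proof
  fix x :: 'a
  show "1 *\<^sub>C x = x"
    using scaleR_scaleC[of 1 x] by simp
qed (simp_all add: scaleC_add_right scaleC_add_left scaleC_scaleC)

definition orthonormal_basis :: "'a::complex_inner set \<Rightarrow> bool" where
  "orthonormal_basis X \<longleftrightarrow>
     (\<forall>x\<in>X. \<forall>y\<in>X. cinner x y = (if x = y then 1 else 0)) \<and> closure (cvs.span X) = UNIV"

definition clinear_op :: "('a::complex_inner \<Rightarrow> 'b::complex_inner) \<Rightarrow> bool" where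
  "clinear_op f \<longleftrightarrow> (\<forall>x y. f (x + y) = f x + f y) \<and> (\<forall>c x. f (c *\<^sub>C x) = c *\<^sub>C f x)"

definition bounded_clinear_op :: "('a::complex_inner \<Rightarrow> 'b::complex_inner) \<Rightarrow> bool" where
  "bounded_clinear_op f \<longleftrightarrow> clinear_op f \<and> (\<exists>c. \<forall>x. norm (f x) \<le> c * norm x)"

text \<open>The open unit ball of the space of bounded operators with the operator norm.\<close>

definition op_unit_ball :: "('a::complex_inner \<Rightarrow> 'b::complex_inner) set" where
  "op_unit_ball = {f. bounded_clinear_op f \<and> onorm f < 1}"

text \<open>For bounded operators on Hilbert spaces the adjoint exists by the Riesz representation
  theorem, and it is unique.\<close>

definition cadjoint :: "('a::chilbert_space \<Rightarrow> 'b::chilbert_space) \<Rightarrow> 'b \<Rightarrow> 'a" where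
  "cadjoint f = (THE g. \<forall>x y. cinner (f x) y = cinner x (g y))"

definition unitary_op :: "('a::chilbert_space \<Rightarrow> 'a) \<Rightarrow> bool" where
  "unitary_op f \<longleftrightarrow> clinear_op f \<and> surj f \<and> (\<forall>x y. cinner (f x) (f y) = cinner x y)"

definition normal_op :: "('a::chilbert_space \<Rightarrow> 'a) \<Rightarrow> bool" where
  "normal_op f \<longleftrightarrow> bounded_clinear_op f \<and> f \<circ> cadjoint f = cadjoint f \<circ> f"

definition positive_op :: "('a::chilbert_space \<Rightarrow> 'a) \<Rightarrow> bool" where
  "positive_op f \<longleftrightarrow> bounded_clinear_op f \<and> (\<forall>x. cinner (f x) x \<in> \<real>\<^sub>\<ge>\<^sub>0)"

text \<open>The unique positive square root of a positive operator, and the inverse of this root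
  for an invertible positive operator.\<close>

definition sqrt_op :: "('a::chilbert_space \<Rightarrow> 'a) \<Rightarrow> 'a \<Rightarrow> 'a" where
  "sqrt_op f = (THE g. positive_op g \<and> g \<circ> g = f)"

definition inv_sqrt_op :: "('a::chilbert_space \<Rightarrow> 'a) \<Rightarrow> 'a \<Rightarrow> 'a" where
  "inv_sqrt_op f = inv (sqrt_op f)"

definition herm_form ::
  "'h::chilbert_space \<times> 'k::chilbert_space \<Rightarrow> 'h \<times> 'k \<Rightarrow> complex" where
  "herm_form x y = cinner (fst x) (fst y) - cinner (snd x) (snd y)"

definition form_group :: "('h::chilbert_space \<times> 'k::chilbert_space \<Rightarrow> 'h \<times> 'k) set" where
  "form_group = {T. clinear_op T \<and> bij T \<and> (\<forall>x y. herm_form (T x) (T y) = herm_form x y)}"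

definition block_op ::
  "('h \<Rightarrow> 'h) \<Rightarrow> ('k \<Rightarrow> 'h) \<Rightarrow> ('h \<Rightarrow> 'k) \<Rightarrow> ('k \<Rightarrow> 'k)
    \<Rightarrow> 'h::chilbert_space \<times> 'k::chilbert_space \<Rightarrow> 'h \<times> 'k" where
  "block_op P Q R S = (\<lambda>(h, k). (P h + Q k, R h + S k))"

definition eigenvalue_op :: "('a::complex_inner \<Rightarrow> 'a) \<Rightarrow> complex \<Rightarrow> bool" where
  "eigenvalue_op f c \<longleftrightarrow> (\<exists>v. v \<noteq> 0 \<and> f v = c *\<^sub>C v)"

text \<open>The matrix of \<open>f\<close> with respect to the ordered basis \<open>b 1, \<dots>, b m\<close> of an
  \<open>f\<close>-invariant subspace, extended by zero outside the index range \<open>1, \<dots>, m\<close>: column \<open>q\<close>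
  holds the coordinates of \<open>f (b q)\<close>.\<close>

definition matrix_of ::
  "nat \<Rightarrow> (nat \<Rightarrow> 'a::complex_inner) \<Rightarrow> ('a \<Rightarrow> 'a) \<Rightarrow> nat \<Rightarrow> nat \<Rightarrow> complex" where
  "matrix_of m b f = (\<lambda>p q. if p \<in> {1..m} \<and> q \<in> {1..m}
     then cvs.representation (b ` {1..m}) (f (b q)) (b p) else 0)"

end

theory Submission
  imports Defs
begin

text \<open>A singular value decomposition \<open>A x = \<Sum>\<^sub>i s\<^sub>i \<langle>x, v\<^sub>i\<rangle> u\<^sub>i\<close> makes every operator explicit:
  \<open>B\<close> and \<open>E\<close> are the identity plus a diagonal map on the \<open>u\<^sub>i\<close>, respectively the \<open>v\<^sub>i\<close>,
  and \<open>C\<close> maps \<open>v\<^sub>i\<close> to a multiple of \<open>u\<^sub>i\<close>. Writing \<open>T = D W\<close> with \<open>D\<close> positive and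
  \<open>W = U \<oplus> V\<close> unitary, \<open>T\<close> is normal iff \<open>W\<close> commutes with \<open>D\<^sup>2\<close>, which amounts to
  \<open>E V = V E\<close> and \<open>C V = U C\<close>. The first equation says that \<open>V\<close> preserves the eigenspaces
  \<open>K\<^sub>i\<close> of \<open>E\<close>; as \<open>C\<close> is a multiple of an isometry from \<open>K\<^sub>i\<close> onto \<open>M\<^sub>i\<close> and vanishes on the
  orthogonal complement of all the \<open>K\<^sub>i\<close>, the second one says that \<open>U\<close> preserves \<open>M\<^sub>i\<close> and has
  there the same matrix as \<open>V\<close> on \<open>K\<^sub>i\<close>. The operator is never unitary, because \<open>E\<close> strictly
  increases the norm on \<open>K\<^sub>1\<close>.\<close>

section \<open>Complex inner products\<close>

lemma cinner_add_right: "cinner x (y + z) = cinner x y + cinner x (z::'a::complex_inner)"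
  by (metis cinner_add_left cinner_commute complex_cnj_add)

lemma cinner_scaleC_right: "cinner x (c *\<^sub>C y) = cnj c * cinner x (y::'a::complex_inner)"
  by (metis cinner_commute cinner_scaleC_left complex_cnj_mult)

lemma cinner_zero_left [simp]: "cinner 0 (x::'a::complex_inner) = 0"
  using cinner_add_left[of 0 0 x] by simp

lemma cinner_zero_right [simp]: "cinner (x::'a::complex_inner) 0 = 0"
  using cinner_add_right[of x 0 0] by simp

lemma cinner_minus_left: "cinner (- x) y = - cinner x (y::'a::complex_inner)"
  using cinner_add_left[of x "- x" y] by (simp add: eq_neg_iff_add_eq_0 add.commute)

lemma cinner_minus_right: "cinner x (- y) = - cinner x (y::'a::complex_inner)"
  using cinner_add_right[of x y "- y"] by (simp add: eq_neg_iff_add_eq_0 add.commute)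

lemma cinner_diff_left: "cinner (x - y) z = cinner x z - cinner y (z::'a::complex_inner)"
  using cinner_add_left[of x "- y" z] by (simp add: cinner_minus_left)

lemma cinner_diff_right: "cinner x (y - z) = cinner x y - cinner x (z::'a::complex_inner)"
  using cinner_add_right[of x y "- z"] by (simp add: cinner_minus_right)

lemma cinner_sum_left: "cinner (\<Sum>i\<in>I. f i) y = (\<Sum>i\<in>I. cinner (f i) (y::'a::complex_inner))"
  by (induction I rule: infinite_finite_induct) (auto simp: cinner_add_left)

lemma cinner_sum_right: "cinner y (\<Sum>i\<in>I. f i) = (\<Sum>i\<in>I. cinner (y::'a::complex_inner) (f i))"
  by (induction I rule: infinite_finite_induct) (auto simp: cinner_add_right)

lemma cinner_self_eq_0 [simp]: "cinner x x = 0 \<longleftrightarrow> x = (0::'a::complex_inner)"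
  by (simp add: cinner_self)

lemma cinner_eq_zero_sym: "cinner x y = 0 \<longleftrightarrow> cinner y x = (0::complex)"
  for x y :: "'a::complex_inner"
  by (metis cinner_commute complex_cnj_zero)

lemma cinner_ext_right: "(\<And>x. cinner x y = cinner x z) \<Longrightarrow> y = (z::'a::complex_inner)"
  by (metis cinner_diff_right cinner_self_eq_0 diff_self eq_iff_diff_eq_0)

lemma norm_scaleC: "norm (c *\<^sub>C x) = cmod c * norm (x::'a::complex_inner)"
proof -
  have "complex_of_real ((norm (c *\<^sub>C x))\<^sup>2) = c * cnj c * complex_of_real ((norm x)\<^sup>2)"
    by (simp only: cinner_self[symmetric] cinner_scaleC_left cinner_scaleC_right mult_ac)
  also have "\<dots> = complex_of_real ((cmod c * norm x)\<^sup>2)"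
    by (simp only: complex_norm_square[symmetric] of_real_mult power_mult_distrib)
  finally show ?thesis
    by (metis mult_nonneg_nonneg norm_ge_zero of_real_eq_iff power2_eq_imp_eq)
qed

text \<open>Subtracting from \<open>x\<close> its projection onto the line through \<open>y\<close>
  leaves a vector of squared norm \<open>(norm x)^2 - |<x, y>|^2 / (norm y)^2\<close>, which cannot
  be negative.\<close>

lemma cinner_Cauchy_Schwarz: "cmod (cinner x y) \<le> norm x * norm (y::'a::complex_inner)"
proof (cases "y = 0")
  case False
  then have y: "(norm y)\<^sup>2 > 0" by simp
  define b where "b = cinner x y"
  define d where "d = b / complex_of_real ((norm y)\<^sup>2)"
  have dy: "d * cinner y y = b"
    using y by (simp add: d_def cinner_self)
  have yx: "cinner y x = cnj b"
    unfolding b_def by (rule cinner_commute)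
  have "cinner (x - d *\<^sub>C y) (x - d *\<^sub>C y)
      = cinner x x - cnj d * b - d * cnj b + cnj d * (d * cinner y y)"
    unfolding cinner_diff_left cinner_diff_right cinner_scaleC_left cinner_scaleC_right yx
      b_def[symmetric]
    by (simp only: algebra_simps)
  also have "\<dots> = cinner x x - d * cnj b"
    by (simp add: dy)
  also have "d * cnj b = complex_of_real ((cmod b)\<^sup>2 / (norm y)\<^sup>2)"
    by (simp only: d_def times_divide_eq_left complex_norm_square[symmetric] of_real_divide)
  finally have "(norm (x - d *\<^sub>C y))\<^sup>2 = (norm x)\<^sup>2 - (cmod b)\<^sup>2 / (norm y)\<^sup>2"
    by (simp only: cinner_self of_real_diff[symmetric] of_real_eq_iff)
  then have "(cmod b)\<^sup>2 / (norm y)\<^sup>2 \<le> (norm x)\<^sup>2"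
    by (metis diff_ge_0_iff_ge zero_le_power2)
  then have "(cmod b)\<^sup>2 \<le> (norm x * norm y)\<^sup>2"
    using y by (simp add: power_mult_distrib divide_le_eq)
  then show ?thesis
    unfolding b_def by (rule power2_le_imp_le) simp
qed simp

section \<open>Linear, bounded and unitary operators; adjoints\<close>

lemma clinear_opI:
  "(\<And>x y. f (x + y) = f x + f y) \<Longrightarrow> (\<And>c x. f (c *\<^sub>C x) = c *\<^sub>C f x) \<Longrightarrow> clinear_op f"
  by (simp add: clinear_op_def)

lemma clinear_op_add: "clinear_op f \<Longrightarrow> f (x + y) = f x + f y"
  by (simp add: clinear_op_def)

lemma clinear_op_scaleC: "clinear_op f \<Longrightarrow> f (c *\<^sub>C x) = c *\<^sub>C f x"
  by (simp add: clinear_op_def)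

lemma clinear_op_scaleR: "clinear_op f \<Longrightarrow> f (r *\<^sub>R x) = r *\<^sub>R f x"
  by (simp add: scaleR_scaleC clinear_op_scaleC)

lemma clinear_op_zero: "clinear_op f \<Longrightarrow> f 0 = 0"
  by (metis add_cancel_right_right clinear_op_add)

lemma clinear_op_minus: "clinear_op f \<Longrightarrow> f (- x) = - f x"
  by (metis add_eq_0_iff clinear_op_add clinear_op_zero right_minus)

lemma clinear_op_diff: "clinear_op f \<Longrightarrow> f (x - y) = f x - f y"
  using clinear_op_add[of f x "- y"] by (simp add: clinear_op_minus)

lemma clinear_op_sum: "clinear_op f \<Longrightarrow> f (\<Sum>i\<in>I. g i) = (\<Sum>i\<in>I. f (g i))"
  by (induction I rule: infinite_finite_induct) (auto simp: clinear_op_zero clinear_op_add)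

lemma clinear_op_comp: "clinear_op f \<Longrightarrow> clinear_op g \<Longrightarrow> clinear_op (f \<circ> g)"
  by (simp add: clinear_op_def)

lemma clinear_op_id_plus: "clinear_op f \<Longrightarrow> clinear_op (\<lambda>x. x + f x)"
  by (simp add: clinear_op_def scaleC_add_right)

lemma clinear_op_image_span:
  assumes "clinear_op f"
  shows "f ` cvs.span X = cvs.span (f ` X)"
proof -
  interpret f: Vector_Spaces.linear scaleC scaleC f
    using assms by unfold_locales (auto simp: clinear_op_def)
  show ?thesis by (rule f.span_image[symmetric])
qed

text \<open>Reduces an intertwining relation such as \<open>E V = V E\<close> or
  \<open>C V = U C\<close> to a check on spanning vectors.\<close>

lemma clinear_op_comp_eq_on_span:
  assumes "clinear_op f" "clinear_op g" "clinear_op f'" "clinear_op g'"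
    and "\<And>x. x \<in> X \<Longrightarrow> f (g x) = f' (g' x)" "x \<in> cvs.span X"
  shows "f (g x) = f' (g' x)"
  using assms(6)
  by (induction rule: cvs.span_induct_alt)
    (auto simp: assms(5) assms(1-4)[THEN clinear_op_zero] assms(1-4)[THEN clinear_op_add]
      assms(1-4)[THEN clinear_op_scaleC])

lemma bounded_clinear_op_imp_bounded_linear:
  assumes "bounded_clinear_op f"
  shows "bounded_linear f"
proof -
  obtain c where c: "\<And>x. norm (f x) \<le> c * norm x" and f: "clinear_op f"
    using assms by (auto simp: bounded_clinear_op_def)
  show ?thesis
    by (rule bounded_linear_intro[of _ c])
      (use c in \<open>auto simp: clinear_op_add[OF f] clinear_op_scaleC[OF f] scaleR_scaleC mult.commute\<close>)
qed

lemma bounded_clinear_op_iff: "bounded_clinear_op f \<longleftrightarrow> clinear_op f \<and> bounded_linear f"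
proof
  assume "clinear_op f \<and> bounded_linear f"
  then show "bounded_clinear_op f"
    by (auto simp: bounded_clinear_op_def intro!: exI[of _ "onorm f"] onorm)
qed (auto simp: bounded_clinear_op_imp_bounded_linear bounded_clinear_op_def)

text \<open>The inner product separates points, so there is at most one adjoint; exhibiting one
  candidate therefore evaluates the \<open>THE\<close>.\<close>

lemma cadjoint_eqI:
  assumes "\<And>x y. cinner (f x) y = cinner x (g y)"
  shows "cadjoint f = g"
  unfolding cadjoint_def
proof (rule the_equality)
  fix h assume "\<forall>x y. cinner (f x) y = cinner x (h y)"
  then have *: "cinner x (h y) = cinner x (g y)" for x y
    by (simp add: assms[symmetric])
  show "h = g"
    by (rule ext, rule cinner_ext_right, rule *)
qed (use assms in simp)

lemma unitary_op_simps:
  assumes "unitary_op U"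
  shows "cinner (U x) (U y) = cinner x y" "norm (U x) = norm x" "U (inv U x) = x" "inv U (U x) = x"
    "U x = U y \<longleftrightarrow> x = y" "cinner (U x) y = cinner x (inv U y)"
proof -
  have lin: "clinear_op U" and U: "\<And>x y. cinner (U x) (U y) = cinner x y" and "surj U"
    using assms by (auto simp: unitary_op_def)
  show "cinner (U x) (U y) = cinner x y" by (rule U)
  have nrm: "norm (U x) = norm x" for x
  proof -
    have "complex_of_real ((norm (U x))\<^sup>2) = complex_of_real ((norm x)\<^sup>2)"
      using U[of x x] by (simp only: cinner_self)
    then have "(norm (U x))\<^sup>2 = (norm x)\<^sup>2"
      by (simp only: of_real_eq_iff)
    then show ?thesis by simp
  qed
  then show "norm (U x) = norm x" .
  \<comment> \<open>Norm preservation makes the kernel trivial.\<close>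
  have "inj U"
  proof (rule injI)
    fix x y assume "U x = U y"
    then have "U (x - y) = 0" by (simp add: clinear_op_diff[OF lin])
    then have "norm (x - y) = 0" using nrm[of "x - y"] by simp
    then show "x = y" by simp
  qed
  then show "U x = U y \<longleftrightarrow> x = y" "inv U (U x) = x" by (auto simp: inj_eq)
  have *: "U (inv U x) = x" for x using \<open>surj U\<close> by (simp add: surj_f_inv_f)
  then show "U (inv U x) = x" .
  show "cinner (U x) y = cinner x (inv U y)"
    using U[of x "inv U y"] * by simp
qed

lemma unitary_op_bounded:
  assumes "unitary_op U"
  shows "bounded_clinear_op U"
proof -
  have "clinear_op U" using assms by (simp add: unitary_op_def)
  moreover have "norm (U x) \<le> 1 * norm x" for x by (simp add: unitary_op_simps(2)[OF assms])
  ultimately show ?thesis unfolding bounded_clinear_op_def by blast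
qed

lemma unitary_op_inv:
  assumes "unitary_op U"
  shows "unitary_op (inv U)"
  unfolding unitary_op_def
proof (intro conjI allI clinear_opI)
  note u = unitary_op_simps[OF assms]
  have lin: "clinear_op U" using assms by (simp add: unitary_op_def)
  show "inv U (x + y) = inv U x + inv U y" for x y
    by (subst u(5)[symmetric]) (simp add: clinear_op_add[OF lin] u)
  show "inv U (c *\<^sub>C x) = c *\<^sub>C inv U x" for c x
    by (subst u(5)[symmetric]) (simp add: clinear_op_scaleC[OF lin] u)
  show "surj (inv U)"
    by (metis surjI u(4))
  show "cinner (inv U x) (inv U y) = cinner x y" for x y
    by (subst u(1)[symmetric]) (simp add: u)
qed

section \<open>Finite-rank diagonal maps over orthonormal families\<close>

definition orthonormal_on :: "'i set \<Rightarrow> ('i \<Rightarrow> 'a::complex_inner) \<Rightarrow> bool" where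
  "orthonormal_on I u \<longleftrightarrow>
     finite I \<and> (\<forall>i\<in>I. \<forall>j\<in>I. cinner (u i) (u j) = (if i = j then 1 else 0))"

text \<open>For orthonormal families this is a singular value form, and for \<open>w = z\<close> a
  spectral form; with \<open>w = z\<close> orthonormal and all coefficients 1 it is the orthogonal
  projection onto the span.\<close>

definition diag_map :: "'i set \<Rightarrow> ('i \<Rightarrow> real) \<Rightarrow> ('i \<Rightarrow> 'a::complex_inner)
    \<Rightarrow> ('i \<Rightarrow> 'b::complex_inner) \<Rightarrow> 'a \<Rightarrow> 'b" where
  "diag_map I c w z x = (\<Sum>i\<in>I. (complex_of_real (c i) * cinner x (w i)) *\<^sub>C z i)"

lemma clinear_diag_map: "clinear_op (diag_map I c w z)"
  by (rule clinear_opI)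
    (simp_all add: diag_map_def cinner_add_left cinner_scaleC_left distrib_left scaleC_add_left
      sum.distrib cvs.scale_sum_right mult_ac)

lemma bounded_diag_map: "bounded_clinear_op (diag_map I c w z)"
  unfolding bounded_clinear_op_def
proof (intro conjI clinear_diag_map exI allI)
  fix x
  have "norm (diag_map I c w z x) \<le> (\<Sum>i\<in>I. norm ((complex_of_real (c i) * cinner x (w i)) *\<^sub>C z i))"
    unfolding diag_map_def by (rule norm_sum)
  also have "\<dots> \<le> (\<Sum>i\<in>I. (\<bar>c i\<bar> * norm (w i) * norm (z i)) * norm x)"
  proof (rule sum_mono)
    fix i
    have "\<bar>c i\<bar> * (cmod (cinner x (w i)) * norm (z i)) \<le> \<bar>c i\<bar> * ((norm x * norm (w i)) * norm (z i))"
      by (intro mult_left_mono mult_right_mono cinner_Cauchy_Schwarz) auto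
    then show "norm ((complex_of_real (c i) * cinner x (w i)) *\<^sub>C z i)
        \<le> (\<bar>c i\<bar> * norm (w i) * norm (z i)) * norm x"
      by (simp add: norm_scaleC norm_mult mult_ac)
  qed
  finally show "norm (diag_map I c w z x) \<le> (\<Sum>i\<in>I. \<bar>c i\<bar> * norm (w i) * norm (z i)) * norm x"
    by (simp add: sum_distrib_right)
qed

text \<open>Real coefficients are unchanged by conjugation, so exchanging the two families gives the
  adjoint.\<close>

lemma cinner_diag_map_adjoint: "cinner (diag_map I c w z x) y = cinner x (diag_map I c z w y)"
proof -
  have "cinner (z i) y = cnj (cinner y (z i))" for i by (rule cinner_commute)
  then show ?thesis
    by (simp add: diag_map_def cinner_sum_left cinner_sum_right cinner_scaleC_left
      cinner_scaleC_right mult_ac)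
qed

lemma cinner_diag_map:
  assumes "orthonormal_on I z" "j \<in> I"
  shows "cinner (diag_map I c w z x) (z j) = complex_of_real (c j) * cinner x (w j)"
proof -
  have "cinner (diag_map I c w z x) (z j)
      = (\<Sum>i\<in>I. if i = j then complex_of_real (c i) * cinner x (w i) else 0)"
    unfolding diag_map_def cinner_sum_left
    using assms by (intro sum.cong) (auto simp: cinner_scaleC_left orthonormal_on_def)
  then show ?thesis
    using assms by (simp add: orthonormal_on_def)
qed

lemma diag_map_basis:
  assumes "orthonormal_on I w" "j \<in> I"
  shows "diag_map I c w z (w j) = complex_of_real (c j) *\<^sub>C z j"
proof -
  have "diag_map I c w z (w j) = (\<Sum>i\<in>I. if i = j then complex_of_real (c i) *\<^sub>C z i else 0)"
    unfolding diag_map_def using assms by (intro sum.cong) (auto simp: orthonormal_on_def)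
  then show ?thesis
    using assms by (simp add: orthonormal_on_def)
qed

lemma diag_map_orthogonal: "(\<And>i. i \<in> I \<Longrightarrow> cinner x (w i) = 0) \<Longrightarrow> diag_map I c w z x = 0"
  by (simp add: diag_map_def)

text \<open>Orthonormality of the shared middle family \<open>z\<close> removes all cross
  terms.\<close>

lemma diag_map_comp:
  assumes "orthonormal_on I z"
  shows "diag_map I d z y (diag_map I c w z x) = diag_map I (\<lambda>i. c i * d i) w y x"
  unfolding diag_map_def[of I d z y] diag_map_def[of I _ w y]
  by (rule sum.cong) (simp_all add: cinner_diag_map[OF assms] mult_ac)

lemma diag_map_add: "diag_map I c w z x + diag_map I d w z x = diag_map I (\<lambda>i. c i + d i) w z x"
  by (simp add: diag_map_def sum.distrib[symmetric] scaleC_add_left[symmetric] distrib_right)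

lemma diag_map_minus: "- diag_map I c w z x = diag_map I (\<lambda>i. - c i) w z x"
  by (simp add: diag_map_def sum_negf)

lemma diag_map_cong: "(\<And>i. i \<in> I \<Longrightarrow> c i = d i) \<Longrightarrow> diag_map I c w z x = diag_map I d w z x"
  by (simp add: diag_map_def)

text \<open>The hypothesis on \<open>b\<close> is \<open>(1 + c i) * (1 + d i) = 1 + b i\<close>
  expanded: the eigenvalues at \<open>u i\<close> multiply, and orthogonally to the family both
  factors are the identity.\<close>

lemma id_plus_diag_map_comp:
  assumes "orthonormal_on I u" "\<And>i. i \<in> I \<Longrightarrow> c i + d i + c i * d i = b i"
  shows "(x + diag_map I c u u x) + diag_map I d u u (x + diag_map I c u u x)
    = x + diag_map I b u u x"
proof -
  have "(x + diag_map I c u u x) + diag_map I d u u (x + diag_map I c u u x)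
    = x + diag_map I (\<lambda>i. c i + d i + c i * d i) u u x"
    by (simp add: clinear_op_add[OF clinear_diag_map] diag_map_comp[OF assms(1)] diag_map_add
        add.assoc)
  then show ?thesis
    by (simp add: diag_map_cong[OF assms(2)])
qed

lemma orthonormal_residual:
  assumes "orthonormal_on I u" "i \<in> I"
  shows "cinner (x - diag_map I (\<lambda>_. 1) u u x) (u i) = 0"
  by (simp add: cinner_diff_left cinner_diag_map[OF assms])

lemma cinner_diag_map_self:
  "cinner (diag_map I c u u x) x = complex_of_real (\<Sum>i\<in>I. c i * (cmod (cinner x (u i)))\<^sup>2)"
proof -
  have "cinner (u i) x = cnj (cinner x (u i))" for i by (rule cinner_commute)
  then show ?thesis
    by (simp add: diag_map_def cinner_sum_left cinner_scaleC_left mult.assoc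
        complex_norm_square del: of_real_power)
qed

text \<open>The residual \<open>x - ?P x\<close> is orthogonal to the projection
  \<open>?P x\<close>, so its squared norm is the difference of the two sides.\<close>

lemma Bessel_inequality:
  assumes "orthonormal_on I u"
  shows "(\<Sum>i\<in>I. (cmod (cinner x (u i)))\<^sup>2) \<le> (norm x)\<^sup>2"
proof -
  let ?P = "diag_map I (\<lambda>_. 1) u u"
  have "cinner (x - ?P x) (?P x) = 0"
    using cinner_diag_map_adjoint[of I "\<lambda>_. 1" u u "x - ?P x" x]
    by (simp add: diag_map_orthogonal[OF orthonormal_residual[OF assms]])
  then have "cinner (x - ?P x) (x - ?P x) = cinner (x - ?P x) x"
    by (simp add: cinner_diff_right)
  also have "\<dots> = complex_of_real ((norm x)\<^sup>2 - (\<Sum>i\<in>I. (cmod (cinner x (u i)))\<^sup>2))"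
    by (simp add: cinner_diff_left cinner_diag_map_self cinner_self)
  finally have "(norm (x - ?P x))\<^sup>2 = (norm x)\<^sup>2 - (\<Sum>i\<in>I. (cmod (cinner x (u i)))\<^sup>2)"
    by (metis cinner_self of_real_eq_iff)
  then show ?thesis
    by (metis diff_ge_0_iff_ge zero_le_power2)
qed

lemma bounded_id_plus_diag_map: "bounded_clinear_op (\<lambda>x. x + diag_map I c u u x)"
  using bounded_diag_map[of I c u u]
  by (auto simp: bounded_clinear_op_iff clinear_op_id_plus intro!: bounded_linear_add)

text \<open>The quadratic form is \<open>(norm x)^2\<close> plus the sum of
  \<open>|<x, u i>|^2\<close> weighted by \<open>c i\<close>; weights of at least -1 subtract no
  more than Bessel's inequality allows.\<close>

lemma positive_id_plus_diag_map:
  assumes "orthonormal_on I u" "\<And>i. i \<in> I \<Longrightarrow> c i \<ge> -1"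
  shows "positive_op (\<lambda>x. x + diag_map I c u u x)"
  unfolding positive_op_def
proof (intro conjI allI bounded_id_plus_diag_map)
  fix x
  let ?q = "(norm x)\<^sup>2 + (\<Sum>i\<in>I. c i * (cmod (cinner x (u i)))\<^sup>2)"
  have "(\<Sum>i\<in>I. (-1) * (cmod (cinner x (u i)))\<^sup>2) \<le> (\<Sum>i\<in>I. c i * (cmod (cinner x (u i)))\<^sup>2)"
    by (intro sum_mono mult_right_mono assms(2)) auto
  then have "0 \<le> ?q"
    using Bessel_inequality[OF assms(1), of x] by (simp add: sum_negf)
  moreover have "cinner (x + diag_map I c u u x) x = complex_of_real ?q"
    by (simp add: cinner_add_left cinner_diag_map_self cinner_self)
  ultimately show "cinner (x + diag_map I c u u x) x \<in> \<real>\<^sub>\<ge>\<^sub>0"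
    by (simp only: nonneg_Reals_of_real_iff)
qed

section \<open>Positive square roots and their inverses\<close>

text \<open>Unless it vanishes, the defect \<open>g x - m x\<close> is an eigenvector of
  \<open>g\<close> for the negative number \<open>- m\<close>, which positivity excludes.\<close>

lemma positive_sqrt_on_eigenvector:
  assumes "positive_op g" "g (g x) = complex_of_real (m\<^sup>2) *\<^sub>C x" "m > 0"
  shows "g x = complex_of_real m *\<^sub>C x"
proof -
  have lin: "clinear_op g" using assms by (simp add: positive_op_def bounded_clinear_op_def)
  define y where "y = g x - complex_of_real m *\<^sub>C x"
  have "g y = - complex_of_real m *\<^sub>C y"
    by (simp add: y_def clinear_op_diff[OF lin] clinear_op_scaleC[OF lin] assms(2)
        cvs.scale_right_diff_distrib power2_eq_square)
  then have "cinner (g y) y = complex_of_real (- m * (norm y)\<^sup>2)"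
    by (simp add: cinner_scaleC_left cinner_minus_left cinner_self)
  moreover have "cinner (g y) y \<in> \<real>\<^sub>\<ge>\<^sub>0"
    using assms by (simp add: positive_op_def)
  ultimately have "0 \<le> - m * (norm y)\<^sup>2"
    by (simp only: nonneg_Reals_of_real_iff)
  then have "m * (norm y)\<^sup>2 \<le> 0" by simp
  then have "(norm y)\<^sup>2 \<le> 0"
    using assms(3) by (simp add: mult_le_0_iff)
  then show ?thesis by (simp add: y_def)
qed

text \<open>By \<open>positive_sqrt_on_eigenvector\<close>, \<open>g\<close> is determined on every
  \<open>u i\<close> and also on the orthogonal complement of the family, where \<open>g\<close>
  squares to the identity. Splitting \<open>x\<close> into these two pieces determines
  \<open>g x\<close>.\<close>

lemma positive_sqrt_unique:
  assumes u: "orthonormal_on I u" and r: "\<And>i. i \<in> I \<Longrightarrow> r i > -1"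
    and g: "positive_op g"
    and gg: "\<And>x. g (g x) = x + diag_map I (\<lambda>i. (1 + r i)\<^sup>2 - 1) u u x"
  shows "g x = x + diag_map I r u u x"
proof -
  have lin: "clinear_op g" using g by (simp add: positive_op_def bounded_clinear_op_def)
  have gu: "g (u i) = complex_of_real (1 + r i) *\<^sub>C u i" if "i \<in> I" for i
  proof (rule positive_sqrt_on_eigenvector[OF g])
    show "g (g (u i)) = complex_of_real ((1 + r i)\<^sup>2) *\<^sub>C u i"
      by (simp add: gg diag_map_basis[OF u that] cvs.scale_left_diff_distrib)
  qed (use r[OF that] in simp)
  define y where "y = x - diag_map I (\<lambda>_. 1) u u x"
  have "diag_map I (\<lambda>i. (1 + r i)\<^sup>2 - 1) u u y = 0"
    unfolding y_def by (intro diag_map_orthogonal orthonormal_residual[OF u])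
  then have gy: "g y = y"
    using positive_sqrt_on_eigenvector[OF g, of y 1] by (simp add: gg)
  have "g x = g y + g (diag_map I (\<lambda>_. 1) u u x)"
    by (simp add: y_def clinear_op_add[OF lin, symmetric])
  also have "g (diag_map I (\<lambda>_. 1) u u x) = diag_map I (\<lambda>i. 1 + r i) u u x"
    unfolding diag_map_def clinear_op_sum[OF lin]
    by (rule sum.cong) (simp_all add: clinear_op_scaleC[OF lin] gu mult_ac)
  finally have "g x = y + (diag_map I (\<lambda>_. 1) u u x + diag_map I r u u x)"
    by (simp add: gy diag_map_add)
  then show ?thesis
    by (simp add: y_def)
qed

text \<open>The coefficients are written so that the operator has the eigenvalues
  \<open>(1 + r i)^2\<close>; \<open>r i > -1\<close> selects the positive roots.\<close>

lemma sqrt_op_id_plus_diag_map: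
  assumes u: "orthonormal_on I u" and r: "\<And>i. i \<in> I \<Longrightarrow> r i > -1"
  shows "sqrt_op (\<lambda>x. x + diag_map I (\<lambda>i. (1 + r i)\<^sup>2 - 1) u u x) = (\<lambda>x. x + diag_map I r u u x)"
  unfolding sqrt_op_def
proof (rule the_equality)
  show "positive_op (\<lambda>x. x + diag_map I r u u x) \<and>
    (\<lambda>x. x + diag_map I r u u x) \<circ> (\<lambda>x. x + diag_map I r u u x) =
      (\<lambda>x. x + diag_map I (\<lambda>i. (1 + r i)\<^sup>2 - 1) u u x)"
  proof
    show "positive_op (\<lambda>x. x + diag_map I r u u x)"
      using r by (intro positive_id_plus_diag_map u) (simp add: less_imp_le)
    show "(\<lambda>x. x + diag_map I r u u x) \<circ> (\<lambda>x. x + diag_map I r u u x) =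
        (\<lambda>x. x + diag_map I (\<lambda>i. (1 + r i)\<^sup>2 - 1) u u x)"
      unfolding comp_def
      by (rule ext, rule id_plus_diag_map_comp[OF u]) (simp add: power2_eq_square algebra_simps)
  qed
  show "g = (\<lambda>x. x + diag_map I r u u x)"
    if "positive_op g \<and> g \<circ> g = (\<lambda>x. x + diag_map I (\<lambda>i. (1 + r i)\<^sup>2 - 1) u u x)" for g
    using that by (intro ext positive_sqrt_unique[OF u r]) (auto simp: fun_eq_iff)
qed

lemma inv_id_plus_diag_map:
  assumes u: "orthonormal_on I u" and r: "\<And>i. i \<in> I \<Longrightarrow> r i > -1"
  shows "inv (\<lambda>x. x + diag_map I r u u x) = (\<lambda>x. x + diag_map I (\<lambda>i. 1 / (1 + r i) - 1) u u x)"
proof (rule inv_equality)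
  \<comment> \<open>\<open>1 + r i\<close> times \<open>1 / (1 + r i)\<close> is 1, which is the
    case \<open>b = 0\<close> of \<open>id_plus_diag_map_comp\<close>.\<close>
  have *: "r i + (1 / (1 + r i) - 1) + r i * (1 / (1 + r i) - 1) = 0" if "i \<in> I" for i
    using r[OF that] by (simp add: field_simps)
  have z: "diag_map I (\<lambda>_. 0) u u x = 0" for x by (simp add: diag_map_def)
  show "(x + diag_map I r u u x) +
      diag_map I (\<lambda>i. 1 / (1 + r i) - 1) u u (x + diag_map I r u u x) = x" for x
    by (subst id_plus_diag_map_comp[OF u, where b = "\<lambda>_. 0"]) (use * z in auto)
  show "(y + diag_map I (\<lambda>i. 1 / (1 + r i) - 1) u u y) +
      diag_map I r u u (y + diag_map I (\<lambda>i. 1 / (1 + r i) - 1) u u y) = y" for y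
    by (subst id_plus_diag_map_comp[OF u, where b = "\<lambda>_. 0"])
      (use * z in \<open>auto simp: algebra_simps\<close>)
qed

lemma inv_sqrt_op_id_minus_diag_map:
  assumes u: "orthonormal_on I u" and c: "\<And>i. i \<in> I \<Longrightarrow> c i < 1"
  shows "inv_sqrt_op (\<lambda>x. x - diag_map I c u u x)
    = (\<lambda>x. x + diag_map I (\<lambda>i. 1 / sqrt (1 - c i) - 1) u u x)"
proof -
  \<comment> \<open>Chosen so that \<open>(1 + r i)^2 = 1 - c i\<close>.\<close>
  define r where "r i = sqrt (1 - c i) - 1" for i
  have r: "r i > -1" if "i \<in> I" for i using c[OF that] by (simp add: r_def)
  have "(\<lambda>x. x - diag_map I c u u x) = (\<lambda>x. x + diag_map I (\<lambda>i. (1 + r i)\<^sup>2 - 1) u u x)"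
  proof
    fix x
    have "diag_map I (\<lambda>i. (1 + r i)\<^sup>2 - 1) u u x = diag_map I (\<lambda>i. - c i) u u x"
      using c by (intro diag_map_cong) (simp add: r_def less_imp_le)
    then show "x - diag_map I c u u x = x + diag_map I (\<lambda>i. (1 + r i)\<^sup>2 - 1) u u x"
      by (simp add: diag_map_minus[symmetric])
  qed
  then show ?thesis
    unfolding inv_sqrt_op_def
    by (simp add: sqrt_op_id_plus_diag_map[OF u r] inv_id_plus_diag_map[OF u r]) (simp add: r_def)
qed

section \<open>Singular value decomposition\<close>

lemma inner_vec_eq_Re_cinner: "inner x y = Re (cinner x (y :: complex ^ 'n))"
  by (simp add: inner_vec_def cinner_vec_def cinner_complex_def inner_complex_def)

text \<open>Orthonormality for \<open>cinner\<close> implies orthogonality for the real inner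
  product, hence independence over the reals. The bound is the real dimension, twice the complex
  one; any uniform bound allows a largest set to be chosen.\<close>

lemma orthonormal_set_card_le:
  fixes F :: "(complex ^ 'n) set"
  assumes "orthonormal_on F (\<lambda>v. v)"
  shows "card F \<le> DIM(complex ^ 'n)"
proof -
  have F: "cinner v w = (if v = w then 1 else 0)" if "v \<in> F" "w \<in> F" for v w
    using assms that by (auto simp: orthonormal_on_def)
  have "pairwise orthogonal F"
    by (auto simp: pairwise_def orthogonal_def inner_vec_eq_Re_cinner F)
  moreover have "0 \<notin> F"
    using F[of 0 0] by auto
  ultimately show ?thesis
    by (intro independent_card_le pairwise_orthogonal_independent)
qed

lemma continuous_on_cinner_vec:
  "continuous_on S (\<lambda>x. cinner x (y :: complex ^ 'n))"
  unfolding cinner_vec_def cinner_complex_def by (intro continuous_intros)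

text \<open>Perturbing the maximiser in the direction \<open>z\<close> shows that the bilinear form of
  the nonnegative quadratic form \<open>s\<^sup>2 \<parallel>x\<parallel>\<^sup>2 - \<parallel>A x\<parallel>\<^sup>2\<close> vanishes there.\<close>

lemma cinner_image_maximiser:
  assumes A: "clinear_op A"
    and le: "\<And>t. norm (A (x + t *\<^sub>C z)) \<le> s * norm (x + t *\<^sub>C z)"
    and eq: "norm (A x) = s * norm x"
  shows "cinner (A x) (A z) = complex_of_real (s\<^sup>2) * cinner x z"
proof -
  define q where "q y w = complex_of_real (s\<^sup>2) * cinner y w - cinner (A y) (A w)" for y w
  have q_norm: "q y y = complex_of_real (s\<^sup>2 * (norm y)\<^sup>2 - (norm (A y))\<^sup>2)" for y
    by (simp add: q_def cinner_self)
  define b where "b = q x z"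
  define Q where "Q = s\<^sup>2 * (norm z)\<^sup>2 - (norm (A z))\<^sup>2"
  have zx: "q z x = cnj b"
    using cinner_commute[of z x] cinner_commute[of "A z" "A x"] by (simp add: q_def b_def)
  \<comment> \<open>This keeps \<open>r * Q\<close> below 1, so \<open>r * (r * Q - 2)\<close> is
    negative. The form takes at \<open>x - r b z\<close> this factor times \<open>|b|^2\<close>, and
    being nonnegative there it forces \<open>b = 0\<close>.\<close>
  define r where "r = 1 / (1 + \<bar>Q\<bar>)"
  have r: "r > 0" "r * Q < 1"
    by (auto simp: r_def field_simps)
  define y where "y = x + (- complex_of_real r * b) *\<^sub>C z"
  have "q y y = q x x + cnj (- complex_of_real r * b) * q x z + (- complex_of_real r * b) * q z x
      + (- complex_of_real r * b) * cnj (- complex_of_real r * b) * q z z"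
    unfolding y_def q_def clinear_op_add[OF A] clinear_op_scaleC[OF A] cinner_add_left
      cinner_add_right cinner_scaleC_left cinner_scaleC_right
    by (simp only: algebra_simps)
  also have "q x x = 0"
    by (simp add: q_norm eq power_mult_distrib)
  also have "0 + cnj (- complex_of_real r * b) * q x z + (- complex_of_real r * b) * q z x
      + (- complex_of_real r * b) * cnj (- complex_of_real r * b) * q z z
      = complex_of_real (r * (r * Q - 2)) * (b * cnj b)"
    unfolding zx b_def[symmetric] q_norm[of z] Q_def[symmetric]
    by (simp add: algebra_simps)
  also have "\<dots> = complex_of_real (r * (r * Q - 2) * (cmod b)\<^sup>2)"
    by (simp only: complex_norm_square[symmetric] of_real_mult)
  finally have "s\<^sup>2 * (norm y)\<^sup>2 - (norm (A y))\<^sup>2 = r * (r * Q - 2) * (cmod b)\<^sup>2"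
    unfolding q_norm by (simp only: of_real_eq_iff)
  moreover have "(norm (A y))\<^sup>2 \<le> s\<^sup>2 * (norm y)\<^sup>2"
    using power_mono[OF le[of "- complex_of_real r * b"], of 2]
    by (simp add: y_def power_mult_distrib)
  ultimately have "0 \<le> r * (r * Q - 2) * (cmod b)\<^sup>2" by linarith
  moreover have "r * (r * Q - 2) < 0"
    using r by (simp add: mult_less_0_iff)
  ultimately have "(cmod b)\<^sup>2 \<le> 0"
    by (metis mult_le_0_iff mult_neg_pos not_le zero_le_power2 order_antisym)
  then show ?thesis
    by (simp add: b_def q_def)
qed

text \<open>The right singular vectors are a maximal orthonormal set of eigenvectors of
  \<open>A\<^sup>* A\<close> outside the kernel of \<open>A\<close>; on its orthogonal complement \<open>A\<close> must vanish, since a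
  unit vector maximising \<open>\<parallel>A x\<parallel>\<close> there would enlarge the set.\<close>

lemma singular_value_decomposition:
  fixes A :: "complex ^ 'n \<Rightarrow> 'h::complex_inner"
  assumes "A \<in> op_unit_ball"
  obtains F :: "(complex ^ 'n) set" and u s where
    "orthonormal_on F (\<lambda>v. v)" "orthonormal_on F u" "\<And>v. v \<in> F \<Longrightarrow> 0 < s v"
    "\<And>v. v \<in> F \<Longrightarrow> s v < 1" "A = diag_map F s (\<lambda>v. v) u"
proof -
  have lin: "clinear_op A" and bl: "bounded_linear A" and on: "onorm A < 1"
    using assms by (auto simp: op_unit_ball_def bounded_clinear_op_iff)
  \<comment> \<open>The condition on \<open>z\<close> is the weak form of
    \<open>A* A v = (norm (A v))^2 v\<close>.\<close>
  define good where "good F \<longleftrightarrow> orthonormal_on F (\<lambda>v. v) \<and>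
      (\<forall>v\<in>F. A v \<noteq> 0 \<and> (\<forall>z. cinner (A v) (A z) = complex_of_real ((norm (A v))\<^sup>2) * cinner v z))"
    for F
  have "good {}" by (simp add: good_def orthonormal_on_def)
  moreover have "\<forall>F. good F \<longrightarrow> card F < Suc (DIM(complex ^ 'n))"
    using orthonormal_set_card_le by (auto simp: good_def less_Suc_eq_le)
  \<comment> \<open>\<open>{}\<close> is good and cardinalities are bounded, so a good set of
    largest cardinality exists.\<close>
  ultimately obtain F where F: "good F" and max: "\<And>G. good G \<Longrightarrow> card G \<le> card F"
    using ex_has_greatest_nat[of good "{}" card "Suc (DIM(complex ^ 'n))"] by blast
  have ON: "orthonormal_on F (\<lambda>v. v)" and fin: "finite F"
    using F by (auto simp: good_def orthonormal_on_def)
  have ortho: "\<And>v w. v \<in> F \<Longrightarrow> w \<in> F \<Longrightarrow> cinner v w = (if v = w then 1 else 0)"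
    using F by (auto simp: good_def orthonormal_on_def)
  have Anz: "\<And>v. v \<in> F \<Longrightarrow> A v \<noteq> 0"
    and Aeig: "\<And>v z. v \<in> F \<Longrightarrow> cinner (A v) (A z) = complex_of_real ((norm (A v))\<^sup>2) * cinner v z"
    using F by (auto simp: good_def)
  define N where "N = {x. \<forall>v\<in>F. cinner x v = 0}"
  have N_lin: "x + t *\<^sub>C z \<in> N" if "x \<in> N" "z \<in> N" for x z t
    using that by (simp add: N_def cinner_add_left cinner_scaleC_left)
  have A0: "A x = 0" if "x \<in> N" for x
  proof (rule ccontr)
    assume Ax: "A x \<noteq> 0"
    let ?S = "sphere 0 1 \<inter> N"
    have "closed {x. cinner x v = 0}" for v :: "complex ^ 'n"
      by (rule closed_Collect_eq) (auto intro: continuous_on_cinner_vec)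
    moreover have "N = (\<Inter>v\<in>F. {x. cinner x v = 0})" by (auto simp: N_def)
    ultimately have "closed N" by (metis closed_INT)
    then have "compact ?S" by (intro compact_Int_closed) auto
    have x0: "x \<noteq> 0" using Ax clinear_op_zero[OF lin] by auto
    have unit: "complex_of_real (1 / norm y) *\<^sub>C y \<in> ?S" if "y \<in> N" "y \<noteq> 0" for y
      using that N_lin[of 0 y "complex_of_real (1 / norm y)"]
      by (auto simp: norm_scaleC norm_divide N_def)
    then have "?S \<noteq> {}" using that x0 \<open>x \<in> N\<close> by blast
    moreover have "continuous_on ?S (\<lambda>x. norm (A x))"
      by (intro continuous_intros bounded_linear.continuous_on[OF bl])
    ultimately obtain m where m: "m \<in> ?S" and mm: "\<And>y. y \<in> ?S \<Longrightarrow> norm (A y) \<le> norm (A m)"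
      using continuous_attains_sup[OF \<open>compact ?S\<close>] by metis
    have nm: "norm m = 1" and mN: "m \<in> N" using m by auto
    have bound: "norm (A y) \<le> norm (A m) * norm y" if "y \<in> N" for y
    proof (cases "y = 0")
      case False
      have "norm (A y) / norm y \<le> norm (A m)"
        using mm[OF unit[OF that False]]
        by (simp add: clinear_op_scaleC[OF lin] norm_scaleC norm_divide)
      then show ?thesis using False by (simp add: divide_le_eq)
    qed (simp add: clinear_op_zero[OF lin])
    have Am: "A m \<noteq> 0"
      using bound[OF \<open>x \<in> N\<close>] Ax by auto
    have onN: "cinner (A m) (A z) = complex_of_real ((norm (A m))\<^sup>2) * cinner m z" if "z \<in> N" for z
      using cinner_image_maximiser[OF lin, of m z "norm (A m)"] bound N_lin[OF mN that]
      by (simp add: nm)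
    \<comment> \<open>\<open>m\<close> is orthogonal to \<open>v\<close>, so the eigenvector
      relation for \<open>v\<close> makes \<open>A m\<close> and \<open>A v\<close>
      orthogonal.\<close>
    have onF: "cinner (A m) (A v) = 0" if "v \<in> F" for v
      using Aeig[OF that, of m] mN that cinner_eq_zero_sym[of "A m" "A v"] cinner_eq_zero_sym[of v m]
      by (simp add: N_def)
    \<comment> \<open>The relation is known against vectors of \<open>N\<close>; against the span of
      \<open>F\<close> both sides vanish, so splitting \<open>z\<close> extends it to every
      vector.\<close>
    have all: "cinner (A m) (A z) = complex_of_real ((norm (A m))\<^sup>2) * cinner m z" for z
    proof -
      let ?P = "diag_map F (\<lambda>_. 1) (\<lambda>v. v) (\<lambda>v. v) z"
      have "z - ?P \<in> N"
        using orthonormal_residual[OF ON] by (simp add: N_def)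
      moreover have "cinner m ?P = 0"
        using mN by (simp add: diag_map_def cinner_sum_right cinner_scaleC_right N_def)
      moreover have "cinner (A m) (A ?P) = 0"
        by (simp add: diag_map_def clinear_op_sum[OF lin] clinear_op_scaleC[OF lin]
            cinner_sum_right cinner_scaleC_right onF)
      ultimately show ?thesis
        using onN[of "z - ?P"] by (simp add: clinear_op_diff[OF lin] cinner_diff_right)
    qed
    have mF: "m \<notin> F"
      using mN nm by (auto simp: N_def cinner_self)
    have "good (insert m F)"
      using F mN nm all Am fin cinner_eq_zero_sym
      by (auto simp: good_def orthonormal_on_def N_def cinner_self)
    then show False
      using max[of "insert m F"] fin mF by simp
  qed
  define s where "s v = norm (A v)" for v
  \<comment> \<open>The left singular vectors; their orthonormality comes from the eigenvector
    relation \<open>Aeig\<close>.\<close>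
  define u where "u v = complex_of_real (1 / s v) *\<^sub>C A v" for v
  have s: "s v > 0" if "v \<in> F" for v using Anz[OF that] by (simp add: s_def)
  then have s0: "s v \<noteq> 0" if "v \<in> F" for v using that by (metis less_irrefl)
  show ?thesis
  proof
    show "orthonormal_on F (\<lambda>v. v)" by (rule ON)
    show "0 < s v" if "v \<in> F" for v by (rule s[OF that])
    show "s v < 1" if "v \<in> F" for v
    proof -
      have "complex_of_real ((norm v)\<^sup>2) = 1"
        using ortho[OF that that] by (simp only: cinner_self if_True simp_thms)
      then have "(norm v)\<^sup>2 = 1" by (simp only: of_real_eq_1_iff)
      then have "norm v = 1" using power2_eq_iff_nonneg[of "norm v" 1] by simp
      then show ?thesis using onorm[OF bl, of v] on by (simp add: s_def)
    qed
    show "orthonormal_on F u"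
      using s0 ortho
      by (auto simp: orthonormal_on_def fin u_def cinner_scaleC_left cinner_scaleC_right Aeig
          s_def[symmetric] field_simps power2_eq_square)
    show "A = diag_map F s (\<lambda>v. v) u"
    proof
      fix x
      \<comment> \<open>The residual lies in \<open>N\<close>, where \<open>A\<close> vanishes, so
        only the projection onto the span of \<open>F\<close> contributes.\<close>
      have "A (x - diag_map F (\<lambda>_. 1) (\<lambda>v. v) (\<lambda>v. v) x) = 0"
        using orthonormal_residual[OF ON] by (intro A0) (simp add: N_def)
      then have "A x = A (diag_map F (\<lambda>_. 1) (\<lambda>v. v) (\<lambda>v. v) x)"
        by (simp add: clinear_op_diff[OF lin])
      also have "\<dots> = (\<Sum>v\<in>F. cinner x v *\<^sub>C A v)"
        by (simp add: diag_map_def clinear_op_sum[OF lin] clinear_op_scaleC[OF lin])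
      also have "\<dots> = diag_map F s (\<lambda>v. v) u x"
        unfolding diag_map_def using s0 by (intro sum.cong) (auto simp: u_def)
      finally show "A x = diag_map F s (\<lambda>v. v) u x" .
    qed
  qed
qed

section \<open>Normality of block operators\<close>

lemma bounded_block_op:
  assumes "bounded_clinear_op P" "bounded_clinear_op Q" "bounded_clinear_op R" "bounded_clinear_op S"
  shows "bounded_clinear_op (block_op P Q R S)"
proof -
  have lin: "clinear_op P" "clinear_op Q" "clinear_op R" "clinear_op S"
    and b: "bounded_linear P" "bounded_linear Q" "bounded_linear R" "bounded_linear S"
    using assms by (auto simp: bounded_clinear_op_iff)
  have "clinear_op (block_op P Q R S)"
    by (rule clinear_opI)
      (auto simp: block_op_def scaleC_prod_def scaleC_add_right split: prod.splits
        simp: lin[THEN clinear_op_add] lin[THEN clinear_op_scaleC])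
  moreover have "block_op P Q R S = (\<lambda>x. (P (fst x) + Q (snd x), R (fst x) + S (snd x)))"
    by (auto simp: block_op_def)
  then have "bounded_linear (block_op P Q R S)"
    by (simp only:) (intro bounded_linear_Pair bounded_linear_add
      b[THEN bounded_linear_compose] bounded_linear_fst bounded_linear_snd)
  ultimately show ?thesis by (simp add: bounded_clinear_op_iff)
qed

lemma bounded_clinear_op_comp:
  "bounded_clinear_op f \<Longrightarrow> bounded_clinear_op g \<Longrightarrow> bounded_clinear_op (f \<circ> g)"
  using clinear_op_comp[of f g] bounded_linear_compose[of f g]
  by (simp add: bounded_clinear_op_iff comp_def)

text \<open>Taking adjoints in \<open>C V = U C\<close> gives \<open>V^-1 C' = C' U^-1\<close>;
  multiply by \<open>V\<close> on the left and by \<open>U\<close> on the right.\<close>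

lemma intertwiner_adjoint:
  assumes U: "unitary_op U" and V: "unitary_op V"
    and adj: "\<And>x y. cinner (C x) y = cinner x (C' y)"
    and CV: "\<And>x. C (V x) = U (C x)"
  shows "C' (U y) = V (C' y)"
proof (rule cinner_ext_right)
  fix x
  have "cinner (C (V (inv V x))) (U y) = cinner (inv V x) (C' y)"
    by (simp only: CV unitary_op_simps(1)[OF U] adj)
  also have "\<dots> = cinner x (V (C' y))"
    using unitary_op_simps(1)[OF V, of "inv V x" "C' y"] by (simp add: unitary_op_simps(3)[OF V])
  finally show "cinner x (C' (U y)) = cinner x (V (C' y))"
    by (simp add: unitary_op_simps(3)[OF V] adj)
qed

text \<open>With \<open>D = block_op B C C' E\<close> and \<open>W = U \<oplus> V\<close>, the operator is \<open>D W\<close> with adjoint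
  \<open>W\<^sup>-\<^sup>1 D\<close>, so it is normal iff \<open>W\<close> commutes with \<open>D\<^sup>2\<close>, whose blocks are
  \<open>1 + 2 C C'\<close>, \<open>2 C E\<close>, \<open>2 E C'\<close> and \<open>2 E\<^sup>2 - 1\<close>.\<close>

lemma normal_block_op_iff:
  fixes B U :: "'h::chilbert_space \<Rightarrow> 'h" and E V :: "'k::chilbert_space \<Rightarrow> 'k"
  assumes U: "unitary_op U" and V: "unitary_op V"
    and B: "bounded_clinear_op B" and C: "bounded_clinear_op C"
    and C': "bounded_clinear_op C'" and E: "positive_op E"
    and adj: "\<And>x y. cinner (C x) y = cinner x (C' y)"
    and adjB: "\<And>x y. cinner (B x) y = cinner x (B y)"
    and adjE: "\<And>x y. cinner (E x) y = cinner x (E y)"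
    and BB: "\<And>x. B (B x) = x + C (C' x)"
    and EE: "\<And>x. E (E x) = x + C' (C x)"
    and BC: "\<And>x. B (C x) = C (E x)"
    and CB: "\<And>x. C' (B x) = E (C' x)"
    and surjE: "surj E"
    and sqrtE: "\<And>g. positive_op g \<Longrightarrow> (\<And>x. g (g x) = E (E x)) \<Longrightarrow> g = E"
  shows "normal_op (block_op (B \<circ> U) (C \<circ> V) (C' \<circ> U) (E \<circ> V)) \<longleftrightarrow>
    (\<forall>x. E (V x) = V (E x)) \<and> (\<forall>x. C (V x) = U (C x))" (is "normal_op ?T \<longleftrightarrow> ?comm")
proof -
  have bE: "bounded_clinear_op E" using E by (simp add: positive_op_def)
  note lin = B[unfolded bounded_clinear_op_def, THEN conjunct1]
    C[unfolded bounded_clinear_op_def, THEN conjunct1]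
    C'[unfolded bounded_clinear_op_def, THEN conjunct1]
    bE[unfolded bounded_clinear_op_def, THEN conjunct1]
    unitary_op_bounded[OF U, unfolded bounded_clinear_op_def, THEN conjunct1]
    unitary_op_bounded[OF V, unfolded bounded_clinear_op_def, THEN conjunct1]
  note add = lin[THEN clinear_op_add] and zero = lin[THEN clinear_op_zero]
    and scaleR = lin[THEN clinear_op_scaleR]
  note u = unitary_op_simps[OF U] and v = unitary_op_simps[OF V]
  define S where "S = (\<lambda>x. (inv U (B (fst x) + C (snd x)), inv V (C' (fst x) + E (snd x))))"
  have adj': "cinner (C' x) y = cinner x (C y)" for x y
    by (metis adj cinner_commute)
  have bdd: "bounded_clinear_op ?T"
    by (intro bounded_block_op bounded_clinear_op_comp B C C' bE unitary_op_bounded U V)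
  have S: "cadjoint ?T = S"
  proof (rule cadjoint_eqI)
    fix x y
    show "cinner (?T x) y = cinner x (S y)"
      by (cases x; cases y)
        (simp add: block_op_def S_def cinner_prod_def cinner_add_left cinner_add_right adj adj'
          adjB adjE u(6) v(6)
          unitary_op_inv[OF U, unfolded unitary_op_def, THEN conjunct1, THEN clinear_op_add]
          unitary_op_inv[OF V, unfolded unitary_op_def, THEN conjunct1, THEN clinear_op_add])
  qed
  define D2 where "D2 = (\<lambda>x. (fst x + 2 *\<^sub>R C (C' (fst x)) + 2 *\<^sub>R C (E (snd x)),
      2 *\<^sub>R E (C' (fst x)) + (snd x + 2 *\<^sub>R C' (C (snd x)))))"
  have TS: "?T (S x) = D2 x" for x
    by (simp add: block_op_def S_def D2_def u v add BB EE BC CB scaleR_2)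
  \<comment> \<open>This is \<open>W^-1 D^2 W\<close>, so normality becomes invariance of
    \<open>D2\<close> under conjugation by \<open>W\<close>.\<close>
  have ST: "S (?T (h, k)) = (inv U (fst (D2 (U h, V k))), inv V (snd (D2 (U h, V k))))" for h k
    by (simp add: block_op_def S_def D2_def u v add BB EE BC CB scaleR_2 add_ac)
  have "normal_op ?T \<longleftrightarrow>
      (\<forall>h k. D2 (h, k) = (inv U (fst (D2 (U h, V k))), inv V (snd (D2 (U h, V k)))))"
    by (simp add: normal_op_def bdd S fun_eq_iff TS ST)
  also have "\<dots> \<longleftrightarrow> (\<forall>h k. U (fst (D2 (h, k))) = fst (D2 (U h, V k)) \<and>
        V (snd (D2 (h, k))) = snd (D2 (U h, V k)))"
    by (metis fst_conv snd_conv prod.collapse u(3,4) v(3,4))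
  also have "\<dots> \<longleftrightarrow> ?comm"
  proof
    assume *: "\<forall>h k. U (fst (D2 (h, k))) = fst (D2 (U h, V k)) \<and>
        V (snd (D2 (h, k))) = snd (D2 (U h, V k))"
    \<comment> \<open>Setting \<open>h = 0\<close> isolates the second column of
      \<open>D2\<close>.\<close>
    have 1: "U (C (E k)) = C (E (V k))" for k
      using *[rule_format, of 0 k] by (simp add: D2_def zero scaleR)
    have 2: "V (E (E k)) = E (E (V k))" for k
      using *[rule_format, of 0 k] by (simp add: D2_def zero add EE scaleR)
    \<comment> \<open>\<open>V^-1 E V\<close> is positive with square
      \<open>V^-1 E^2 V = E^2\<close>; uniqueness of the root upgrades commutation with
      \<open>E^2\<close> to commutation with \<open>E\<close>.\<close>
    have "(\<lambda>x. inv V (E (V x))) = E"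
    proof (rule sqrtE)
      show "positive_op (\<lambda>x. inv V (E (V x)))"
        unfolding positive_op_def
      proof (intro conjI allI)
        show "bounded_clinear_op (\<lambda>x. inv V (E (V x)))"
          using bounded_clinear_op_comp[OF unitary_op_bounded[OF unitary_op_inv[OF V]]
              bounded_clinear_op_comp[OF bE unitary_op_bounded[OF V]]]
          by (simp add: comp_def)
        show "cinner (inv V (E (V x))) x \<in> \<real>\<^sub>\<ge>\<^sub>0" for x
        proof -
          have "cinner (E (V x)) (V x) \<in> \<real>\<^sub>\<ge>\<^sub>0" using E by (simp add: positive_op_def)
          then show ?thesis using v(1)[of "inv V (E (V x))" x] by (simp add: v(3))
        qed
      qed
      show "inv V (E (V (inv V (E (V x))))) = E (E x)" for x
        by (simp add: v 2[symmetric])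
    qed
    then have EV: "E (V x) = V (E x)" for x
      by (metis v(3))
    \<comment> \<open>With \<open>E V = V E\<close>, surjectivity of \<open>E\<close> cancels it
      from \<open>U C E = C E V\<close>.\<close>
    have "C (V x) = U (C x)" for x
    proof -
      obtain y where "x = E y" using surjE by blast
      then show ?thesis using 1[of y] EV[of y] by simp
    qed
    with EV show ?comm by blast
  next
    assume comm: ?comm
    \<comment> \<open>This supplies the commutation needed for the blocks containing
      \<open>C'\<close>.\<close>
    then have "C' (U y) = V (C' y)" for y
      using intertwiner_adjoint[OF U V adj, of y] by blast
    with comm show "\<forall>h k. U (fst (D2 (h, k))) = fst (D2 (U h, V k)) \<and>
        V (snd (D2 (h, k))) = snd (D2 (U h, V k))"
      by (simp add: D2_def add scaleR_2)
  qed
  finally show ?thesis .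
qed

section \<open>Matrices in orthogonal bases\<close>

text \<open>The inner product with \<open>b p\<close> kills every other term in the expansion of
  \<open>w\<close> and leaves the coordinate times \<open>d\<close>. The same computation gives
  independence of the basis.\<close>

lemma representation_orthogonal:
  fixes b :: "nat \<Rightarrow> 'a::complex_inner"
  assumes orth: "\<And>p q. p \<in> {1..m} \<Longrightarrow> q \<in> {1..m} \<Longrightarrow>
      cinner (b p) (b q) = (if p = q then d else 0)" and d: "d \<noteq> 0"
    and w: "w \<in> cvs.span (b ` {1..m})" and p: "p \<in> {1..m}"
  shows "cvs.representation (b ` {1..m}) w (b p) = cinner w (b p) / d"
proof -
  let ?X = "b ` {1..m}"
  \<comment> \<open>As \<open>d\<close> is nonzero, distinct indices carry distinct vectors, so
    passing from the family to the set merges nothing.\<close>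
  have X: "cinner x y = (if x = y then d else 0)" if xy: "x \<in> ?X" "y \<in> ?X" for x y
  proof -
    obtain i j where ij: "i \<in> {1..m}" "j \<in> {1..m}" "x = b i" "y = b j" using xy by blast
    show ?thesis
    proof (cases "i = j")
      case False
      then have "cinner x y = 0" using ij orth by simp
      moreover have "cinner x x = d" using ij orth[of i i] by simp
      ultimately show ?thesis using d by auto
    qed (use ij orth[of i i] in simp)
  qed
  have comb: "cinner (\<Sum>x\<in>S. f x *\<^sub>C x) y = f y * d" if "finite S" "S \<subseteq> ?X" "y \<in> S" for S f y
  proof -
    have "cinner (\<Sum>x\<in>S. f x *\<^sub>C x) y = (\<Sum>x\<in>S. if x = y then f x * d else 0)"
      unfolding cinner_sum_left using that X
      by (intro sum.cong) (auto simp: cinner_scaleC_left subset_iff)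
    then show ?thesis using that by simp
  qed
  have "cvs.independent ?X"
  proof
    assume "cvs.dependent ?X"
    then obtain S f v where "finite S" "S \<subseteq> ?X" "v \<in> S" "f v \<noteq> 0" "(\<Sum>x\<in>S. f x *\<^sub>C x) = 0"
      unfolding cvs.dependent_explicit by blast
    then show False using comb[of S v f] d by simp
  qed
  then have "w = (\<Sum>x\<in>?X. cvs.representation ?X w x *\<^sub>C x)"
    using cvs.sum_representation_eq[of ?X w ?X] w by simp
  then have "cinner w (b p) = cvs.representation ?X w (b p) * d"
    using comb[of ?X "b p" "cvs.representation ?X w"] p by auto
  then show ?thesis using d by simp
qed

text \<open>Such a \<open>w\<close> is orthogonal to the whole span, hence to itself.\<close>

lemma cinner_in_span_eq_0:
  assumes "w \<in> cvs.span X" "\<And>x. x \<in> X \<Longrightarrow> cinner w x = 0"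
  shows "w = 0"
proof -
  have "cinner w y = 0" if "y \<in> cvs.span X" for y
    using that by (induction rule: cvs.span_induct_alt)
      (auto simp: assms(2) cinner_add_right cinner_scaleC_right)
  then show ?thesis using assms(1) cinner_self_eq_0 by blast
qed

text \<open>Since \<open>C\<close> is a multiple of an isometry on the span of the basis, the entries of both
  matrices are inner products, and equality of the matrices means that \<open>U C\<close> and \<open>C V\<close> have
  the same inner products with the orthogonal basis \<open>\<xi>\<close>.\<close>

lemma matrix_of_eq_iff:
  assumes lin: "clinear_op C" "clinear_op U" "clinear_op V" and d: "d \<noteq> 0"
    and orth: "\<And>p q. p \<in> {1..m} \<Longrightarrow> q \<in> {1..m} \<Longrightarrow> cinner (e p) (e q) = (if p = q then 1 else 0)"
    and \<xi>: "\<And>p. p \<in> {1..m} \<Longrightarrow> \<xi> p = C (e p)"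
    and C: "\<And>x z. z \<in> cvs.span (e ` {1..m}) \<Longrightarrow> cinner (C x) (C z) = d * cinner x z"
    and Vinv: "V ` cvs.span (e ` {1..m}) \<subseteq> cvs.span (e ` {1..m})"
    and Uinv: "U ` cvs.span (\<xi> ` {1..m}) \<subseteq> cvs.span (\<xi> ` {1..m})"
  shows "matrix_of m \<xi> U = matrix_of m e V \<longleftrightarrow>
    (\<forall>x\<in>cvs.span (e ` {1..m}). C (V x) = U (C x))"
proof -
  let ?K = "cvs.span (e ` {1..m})" and ?M = "cvs.span (\<xi> ` {1..m})"
  have eK: "e p \<in> ?K" if "p \<in> {1..m}" for p using that by (intro cvs.span_base) auto
  have \<xi>M: "\<xi> p \<in> ?M" if "p \<in> {1..m}" for p using that by (intro cvs.span_base) auto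
  have "C ` ?K = cvs.span (C ` e ` {1..m})" by (rule clinear_op_image_span[OF lin(1)])
  also have "C ` e ` {1..m} = \<xi> ` {1..m}" using \<xi> by (force simp: image_image)
  finally have CK: "C ` ?K = ?M" .
  have Ce: "cinner (C x) (C (e p)) = d * cinner x (e p)" if "p \<in> {1..m}" for x p
    by (rule C[OF eK[OF that]])
  have orth\<xi>: "cinner (\<xi> p) (\<xi> q) = (if p = q then d else 0)" if "p \<in> {1..m}" "q \<in> {1..m}" for p q
    using that by (simp add: \<xi> Ce orth)
  have V_entry: "matrix_of m e V p q = cinner (V (e q)) (e p)" if "p \<in> {1..m}" "q \<in> {1..m}" for p q
    using that representation_orthogonal[of m e 1 "V (e q)" p, OF orth] Vinv eK[of q]
    by (auto simp: matrix_of_def)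
  have U_entry: "matrix_of m \<xi> U p q = cinner (U (\<xi> q)) (\<xi> p) / d"
    if "p \<in> {1..m}" "q \<in> {1..m}" for p q
    using that representation_orthogonal[of m \<xi> d "U (\<xi> q)" p, OF orth\<xi> d] Uinv \<xi>M[of q]
    by (auto simp: matrix_of_def)
  have zero: "matrix_of m \<xi> U p q = matrix_of m e V p q" if "\<not> (p \<in> {1..m} \<and> q \<in> {1..m})" for p q
    using that by (auto simp: matrix_of_def)
  have "matrix_of m \<xi> U = matrix_of m e V \<longleftrightarrow>
      (\<forall>p\<in>{1..m}. \<forall>q\<in>{1..m}. matrix_of m \<xi> U p q = matrix_of m e V p q)"
    using zero unfolding fun_eq_iff by blast
  \<comment> \<open>Multiplying by \<open>d\<close> turns the entries for \<open>V\<close> into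
    inner products of \<open>C (V (e q))\<close> with \<open>C (e p)\<close>.\<close>
  also have "\<dots> \<longleftrightarrow> (\<forall>p\<in>{1..m}. \<forall>q\<in>{1..m}. cinner (U (C (e q))) (C (e p)) =
      cinner (C (V (e q))) (C (e p)))"
    using d by (intro ball_cong refl) (simp add: U_entry V_entry \<xi> Ce field_simps)
  also have "\<dots> \<longleftrightarrow> (\<forall>x\<in>?K. C (V x) = U (C x))"
  proof
    assume *: "\<forall>p\<in>{1..m}. \<forall>q\<in>{1..m}. cinner (U (C (e q))) (C (e p)) =
      cinner (C (V (e q))) (C (e p))"
    have "C (V (e q)) = U (C (e q))" if q: "q \<in> {1..m}" for q
    proof -
      \<comment> \<open>The difference of these two vectors of \<open>?M\<close> is orthogonal to
        every \<open>\<xi> p\<close>, hence zero.\<close>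
      have "C (V (e q)) \<in> ?M" "U (C (e q)) \<in> ?M"
        using CK Vinv Uinv eK[OF q] by blast+
      then have "U (C (e q)) - C (V (e q)) \<in> ?M" by (rule cvs.span_diff[rotated])
      then have "U (C (e q)) - C (V (e q)) = 0"
        by (rule cinner_in_span_eq_0) (use * q \<xi> in \<open>auto simp: cinner_diff_left\<close>)
      then show ?thesis by simp
    qed
    then show "\<forall>x\<in>?K. C (V x) = U (C x)"
      using clinear_op_comp_eq_on_span[OF lin(1,3,2,1), of "e ` {1..m}"] by blast
  qed (use eK in auto)
  finally show ?thesis .
qed

theorem proposition1p3:
  fixes A C :: "complex ^ 'n::finite \<Rightarrow> 'h::chilbert_space"
    and B U :: "'h \<Rightarrow> 'h"
    and E V :: "complex ^ 'n \<Rightarrow> complex ^ 'n"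
    and T :: "'h \<times> (complex ^ 'n) \<Rightarrow> 'h \<times> (complex ^ 'n)"
    and l :: nat
    and a :: "nat \<Rightarrow> real"
    and k :: "nat \<Rightarrow> nat"
    and e :: "nat \<Rightarrow> nat \<Rightarrow> complex ^ 'n"
    and \<xi> :: "nat \<Rightarrow> nat \<Rightarrow> 'h"
    and KK :: "nat \<Rightarrow> (complex ^ 'n) set"
    and M :: "nat \<Rightarrow> 'h set"
  assumes dims: "\<not> (\<exists>(X :: 'h set) (Y :: (complex ^ 'n) set).
                     orthonormal_basis X \<and> orthonormal_basis Y \<and> X \<approx> Y)"
    and A: "A \<in> op_unit_ball"
    and U: "unitary_op U"
    and V: "unitary_op V"
    and B: "B = inv_sqrt_op (\<lambda>h. h - A (cadjoint A h))"
    and C: "C = inv_sqrt_op (\<lambda>h. h - A (cadjoint A h)) \<circ> A"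
    and E: "E = inv_sqrt_op (\<lambda>x. x - cadjoint A (A x))"
    and T: "T \<in> form_group"
    and T_eq: "T = block_op (B \<circ> U) (C \<circ> V) (cadjoint C \<circ> U) (E \<circ> V)"
    and l: "l \<ge> 1"
    and a: "bij_betw a {1..l} {c. c > 1 \<and> eigenvalue_op E (complex_of_real c)}"
    and KK: "\<And>i. i \<in> {1..l} \<Longrightarrow> KK i = {x. E x - complex_of_real (a i) *\<^sub>C x = 0}"
    and k: "\<And>i. i \<in> {1..l} \<Longrightarrow> k i = cvs.dim (KK i)"
    and e_orthonormal: "\<And>i p q. i \<in> {1..l} \<Longrightarrow> p \<in> {1..k i} \<Longrightarrow> q \<in> {1..k i} \<Longrightarrow>
           cinner (e i p) (e i q) = (if p = q then 1 else 0)"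
    and e_span: "\<And>i. i \<in> {1..l} \<Longrightarrow> cvs.span (e i ` {1..k i}) = KK i"
    and \<xi>: "\<And>i j. i \<in> {1..l} \<Longrightarrow> j \<in> {1..k i} \<Longrightarrow> \<xi> i j = C (e i j)"
    and M: "\<And>i. i \<in> {1..l} \<Longrightarrow> M i = cvs.span (\<xi> i ` {1..k i})"
  shows "(normal_op T \<and> \<not> unitary_op T) \<longleftrightarrow>
         (\<forall>i\<in>{1..l}. U ` M i = M i \<and> V ` KK i = KK i \<and>
            matrix_of (k i) (\<xi> i) U = matrix_of (k i) (e i) V)"
proof -

  \<comment> \<open>Explicit forms of \<open>B\<close>, \<open>C\<close> and
    \<open>E\<close>\<close>
  obtain F :: "(complex ^ 'n) set" and u :: "complex ^ 'n \<Rightarrow> 'h" and s where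
    v: "orthonormal_on F (\<lambda>v. v)" and u: "orthonormal_on F u"
    and s0: "\<And>v. v \<in> F \<Longrightarrow> 0 < s v" and s1: "\<And>v. v \<in> F \<Longrightarrow> s v < 1"
    and A_eq: "A = diag_map F s (\<lambda>v. v) u"
    by (rule singular_value_decomposition[OF A]) (rule that)
  \<comment> \<open>\<open>\<alpha> v\<close> is the eigenvalue of \<open>E\<close> at
    \<open>v\<close> and of \<open>B\<close> at \<open>u v\<close>; \<open>t v\<close> is the
    singular value of \<open>C\<close> there.\<close>
  define \<alpha> where "\<alpha> v = 1 / sqrt (1 - (s v)\<^sup>2)" for v
  define t where "t v = s v * \<alpha> v" for v
  have ss: "(s v)\<^sup>2 < 1" if "v \<in> F" for v
    using s0[OF that] s1[OF that] by (simp add: power_less_one_iff abs_square_less_1)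
  have \<alpha>1: "\<alpha> v > 1" if "v \<in> F" for v
    using s0[OF that] ss[OF that] by (simp add: \<alpha>_def)
  \<comment> \<open>The scalar form of \<open>C' C = E^2 - I\<close> and
    \<open>C C' = B^2 - I\<close>.\<close>
  have t\<alpha>: "t v * t v = \<alpha> v * \<alpha> v - 1" if "v \<in> F" for v
    using ss[OF that] by (simp add: t_def \<alpha>_def field_simps power2_eq_square)
  have adjA: "cadjoint A = diag_map F s u (\<lambda>v. v)"
    unfolding A_eq by (rule cadjoint_eqI) (rule cinner_diag_map_adjoint)
  have B_eq: "B = (\<lambda>x. x + diag_map F (\<lambda>v. \<alpha> v - 1) u u x)"
    unfolding B adjA unfolding A_eq diag_map_comp[OF v] \<alpha>_def
    using inv_sqrt_op_id_minus_diag_map[OF u, of "\<lambda>v. s v * s v"] ss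
    by (simp add: power2_eq_square)
  have E_eq: "E = (\<lambda>x. x + diag_map F (\<lambda>v. \<alpha> v - 1) (\<lambda>v. v) (\<lambda>v. v) x)"
    unfolding E adjA unfolding A_eq diag_map_comp[OF u] \<alpha>_def
    using inv_sqrt_op_id_minus_diag_map[OF v, of "\<lambda>v. s v * s v"] ss
    by (simp add: power2_eq_square)
  have C_eq: "C = diag_map F t (\<lambda>v. v) u"
  proof
    fix x
    have "C x = A x + diag_map F (\<lambda>v. \<alpha> v - 1) u u (A x)"
      unfolding C B[symmetric] by (simp add: B_eq)
    also have "\<dots> = diag_map F t (\<lambda>v. v) u x"
      by (simp add: A_eq diag_map_comp[OF u] diag_map_add t_def[abs_def] algebra_simps)
    finally show "C x = diag_map F t (\<lambda>v. v) u x" .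
  qed
  define C' where "C' = diag_map F t u (\<lambda>v. v)"
  have adjC: "cinner (C x) y = cinner x (C' y)" for x y
    unfolding C_eq C'_def by (rule cinner_diag_map_adjoint)
  then have C': "cadjoint C = C'" by (rule cadjoint_eqI)
  have linC: "clinear_op C" unfolding C_eq by (rule clinear_diag_map)
  have linE: "clinear_op E" unfolding E_eq by (intro clinear_op_id_plus clinear_diag_map)
  have linU: "clinear_op U" and linV: "clinear_op V"
    using U V by (auto simp: unitary_op_def)
  note u_simps = unitary_op_simps[OF U] and v_simps = unitary_op_simps[OF V]
  have posE: "positive_op E"
    unfolding E_eq by (rule positive_id_plus_diag_map[OF v]) (use \<alpha>1 in force)
  \<comment> \<open>The coefficient is left in the shape that \<open>positive_sqrt_unique\<close>
    expects.\<close>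
  have EE': "E (E x) = x + diag_map F (\<lambda>v. (1 + (\<alpha> v - 1))\<^sup>2 - 1) (\<lambda>v. v) (\<lambda>v. v) x" for x
    unfolding E_eq by (rule id_plus_diag_map_comp[OF v]) (simp add: power2_eq_square algebra_simps)
  have "C' (C x) = diag_map F (\<lambda>v. (1 + (\<alpha> v - 1))\<^sup>2 - 1) (\<lambda>v. v) (\<lambda>v. v) x" for x
    unfolding C_eq C'_def diag_map_comp[OF u]
    by (rule diag_map_cong) (simp add: t\<alpha> power2_eq_square)
  then have EE: "E (E x) = x + C' (C x)" for x by (simp add: EE')
  have BB: "B (B x) = x + C (C' x)" for x
    unfolding B_eq C_eq C'_def diag_map_comp[OF v]
    by (rule id_plus_diag_map_comp[OF u]) (simp add: t\<alpha> algebra_simps)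
  have BC: "B (C x) = C (E x)" for x
    unfolding B_eq C_eq E_eq clinear_op_add[OF clinear_diag_map]
      diag_map_comp[OF u] diag_map_comp[OF v]
    by (simp add: mult.commute)
  have CB: "C' (B x) = E (C' x)" for x
    unfolding B_eq C'_def E_eq clinear_op_add[OF clinear_diag_map]
      diag_map_comp[OF u] diag_map_comp[OF v]
    by (simp add: mult.commute)
  have adjB: "cinner (B x) y = cinner x (B y)" for x y
    by (simp add: B_eq cinner_add_left cinner_add_right cinner_diag_map_adjoint)
  have adjE: "cinner (E x) y = cinner x (E y)" for x y
    by (simp add: E_eq cinner_add_left cinner_add_right cinner_diag_map_adjoint)
  have surjE: "surj E"
  proof (rule surjI)
    fix x
    \<comment> \<open>The preimage uses the eigenvalues \<open>1 / \<alpha> v\<close> of the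
      inverse.\<close>
    show "E (x + diag_map F (\<lambda>v. 1 / \<alpha> v - 1) (\<lambda>v. v) (\<lambda>v. v) x) = x"
      unfolding E_eq
    proof (subst id_plus_diag_map_comp[OF v, where b = "\<lambda>_. 0"])
      show "1 / \<alpha> w - 1 + (\<alpha> w - 1) + (1 / \<alpha> w - 1) * (\<alpha> w - 1) = 0" if "w \<in> F" for w
        using \<alpha>1[OF that] by (simp add: field_simps)
    qed (simp add: diag_map_def)
  qed
  have sqrtE: "g = E" if g: "positive_op g" and gg: "\<And>x. g (g x) = E (E x)" for g
    unfolding E_eq using \<alpha>1 by (intro ext positive_sqrt_unique[OF v _ g]) (force, simp add: gg EE')
  have normal_iff: "normal_op T \<longleftrightarrow> (\<forall>x. E (V x) = V (E x)) \<and> (\<forall>x. C (V x) = U (C x))"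
    unfolding T_eq C'
    by (rule normal_block_op_iff[OF U V _ _ _ posE adjC adjB adjE BB EE BC CB surjE sqrtE])
      (simp_all add: B_eq C_eq C'_def bounded_id_plus_diag_map bounded_diag_map)

  \<comment> \<open>Eigenspaces \<open>KK i\<close> and their images \<open>M i\<close>\<close>
  have KK_iff: "z \<in> KK i \<longleftrightarrow> E z = complex_of_real (a i) *\<^sub>C z" if "i \<in> {1..l}" for i z
    using KK[OF that] by simp
  have a1: "a i > 1" and aE: "eigenvalue_op E (complex_of_real (a i))" if "i \<in> {1..l}" for i
    using bij_betw_apply[OF a that] by auto
  \<comment> \<open>On \<open>KK i\<close> the operator \<open>C' C = E^2 - I\<close> is
    multiplication by \<open>(a i)^2 - 1\<close>.\<close>
  have CC: "cinner (C x) (C z) = complex_of_real ((a i)\<^sup>2 - 1) * cinner x z"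
    if i: "i \<in> {1..l}" and z: "z \<in> KK i" for i x z
  proof -
    have "E (E z) = complex_of_real ((a i)\<^sup>2) *\<^sub>C z"
      using z KK_iff[OF i] by (simp add: clinear_op_scaleC[OF linE] power2_eq_square)
    then have "C' (C z) = complex_of_real ((a i)\<^sup>2 - 1) *\<^sub>C z"
      using EE[of z] by (simp add: cvs.scale_left_diff_distrib eq_diff_eq add.commute)
    then show ?thesis
      by (simp add: adjC cinner_scaleC_right)
  qed
  have nz: "complex_of_real ((a i)\<^sup>2 - 1) \<noteq> 0" if "i \<in> {1..l}" for i
  proof -
    have "(a i)\<^sup>2 > 1" using a1[OF that] by (simp add: one_less_power)
    then show ?thesis by (simp only: of_real_eq_0_iff)
  qed
  have M_eq: "M i = C ` KK i" if i: "i \<in> {1..l}" for i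
  proof -
    have "\<xi> i ` {1..k i} = C ` e i ` {1..k i}" using \<xi>[OF i] by (force simp: image_image)
    then show ?thesis
      by (simp only: M[OF i] clinear_op_image_span[OF linC, symmetric] e_span[OF i])
  qed
  have matrix_iff: "matrix_of (k i) (\<xi> i) U = matrix_of (k i) (e i) V \<longleftrightarrow>
      (\<forall>x\<in>KK i. C (V x) = U (C x))"
    if i: "i \<in> {1..l}" and "U ` M i = M i" "V ` KK i = KK i" for i
    unfolding e_span[OF i, symmetric]
    by (rule matrix_of_eq_iff[OF linC linU linV nz[OF i] e_orthonormal[OF i] \<xi>[OF i] CC[OF i]])
      (use that in \<open>simp_all only: e_span[OF i] M[OF i, symmetric] order_refl\<close>)

  \<comment> \<open>Failure of unitarity\<close>
  have not_unitary: "\<not> unitary_op T"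
  proof
    assume T_unit: "unitary_op T"
    have i: "1 \<in> {1..l}" using l by simp
    obtain z where z: "z \<noteq> 0" "E z = complex_of_real (a 1) *\<^sub>C z"
      using aE[OF i] by (auto simp: eigenvalue_op_def)
    have lin: "clinear_op (cadjoint C)" unfolding C' C'_def by (rule clinear_diag_map)
    \<comment> \<open>The second component \<open>E z = a 1 z\<close> alone is already longer than
      the input.\<close>
    have "T (0, inv V z) = (C z, E z)"
      unfolding T_eq
      using linU lin by (simp add: block_op_def v_simps clinear_op_zero B_eq
          clinear_op_zero[OF clinear_diag_map])
    then have "norm (C z, E z) = norm (0 :: 'h, inv V z)"
      using unitary_op_simps(2)[OF T_unit, of "(0, inv V z)"] by simp
    also have "\<dots> = norm z"
      using v_simps(2)[of "inv V z"] by (simp add: norm_Pair v_simps)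
    finally have "norm (C z, E z) = norm z" .
    moreover have "norm (E z) \<le> norm (C z, E z)"
      by (rule norm_snd_le)
    moreover have "norm (E z) = a 1 * norm z"
      using z a1[OF i] by (simp add: norm_scaleC)
    ultimately show False
      using z a1[OF i] by simp
  qed

  \<comment> \<open>The two directions of the equivalence\<close>
  show ?thesis
  proof
    assume "normal_op T \<and> \<not> unitary_op T"
    then have EV: "\<And>x. E (V x) = V (E x)" and CV: "\<And>x. C (V x) = U (C x)"
      by (auto simp: normal_iff)
    show "\<forall>i\<in>{1..l}. U ` M i = M i \<and> V ` KK i = KK i \<and>
            matrix_of (k i) (\<xi> i) U = matrix_of (k i) (e i) V"
    proof
      fix i assume i: "i \<in> {1..l}"
      \<comment> \<open>Injectivity of \<open>V\<close> makes membership pass both ways, which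
        yields equality and not just inclusion.\<close>
      have V_mem: "V x \<in> KK i \<longleftrightarrow> x \<in> KK i" for x
        by (simp add: KK_iff[OF i] EV clinear_op_scaleC[OF linV, symmetric] v_simps(5))
      have VK: "V ` KK i = KK i"
      proof
        show "KK i \<subseteq> V ` KK i"
          using V_mem v_simps(3) by (metis image_eqI subsetI)
      qed (use V_mem in auto)
      have "U ` M i = C ` V ` KK i"
        unfolding M_eq[OF i] by (simp add: image_image CV)
      then have UM: "U ` M i = M i"
        by (simp add: VK M_eq[OF i])
      show "U ` M i = M i \<and> V ` KK i = KK i \<and> matrix_of (k i) (\<xi> i) U = matrix_of (k i) (e i) V"
        using UM VK CV matrix_iff[OF i UM VK] by blast
    qed
  next
    assume R: "\<forall>i\<in>{1..l}. U ` M i = M i \<and> V ` KK i = KK i \<and>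
            matrix_of (k i) (\<xi> i) U = matrix_of (k i) (e i) V"
    \<comment> \<open>A vector \<open>w\<close> of \<open>F\<close> is an eigenvector of
      \<open>E\<close> for \<open>\<alpha> w > 1\<close>, and \<open>a\<close> enumerates all such
      eigenvalues.\<close>
    have F_KK: "\<exists>i\<in>{1..l}. w \<in> KK i" if w: "w \<in> F" for w
    proof -
      have Ew: "E w = complex_of_real (\<alpha> w) *\<^sub>C w"
        using diag_map_basis[OF v w, of "\<lambda>v. \<alpha> v - 1" "\<lambda>v. v"]
        by (simp add: E_eq cvs.scale_left_diff_distrib)
      have "w \<noteq> 0"
        using v w by (metis cinner_zero_left orthonormal_on_def zero_neq_one)
      then have "\<alpha> w \<in> a ` {1..l}"
        using Ew \<alpha>1[OF w] bij_betw_imp_surj_on[OF a] by (auto simp: eigenvalue_op_def)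
      then obtain i where i: "i \<in> {1..l}" "\<alpha> w = a i" by blast
      then have "w \<in> KK i" using Ew KK_iff[OF i(1)] by simp
      then show ?thesis using i(1) by blast
    qed
    have on_F: "E (V w) = V (E w)" "C (V w) = U (C w)" if w: "w \<in> F" for w
    proof -
      obtain i where i: "i \<in> {1..l}" "w \<in> KK i" using F_KK[OF w] by blast
      have UM: "U ` M i = M i" and VK: "V ` KK i = KK i" using R i by auto
      have "V w \<in> KK i" using VK i by blast
      then show "E (V w) = V (E w)"
        using i KK_iff[OF i(1)] by (simp add: clinear_op_scaleC[OF linV])
      show "C (V w) = U (C w)"
        using matrix_iff[OF i(1) UM VK] R i by blast
    qed
    have on_perp: "E y = y \<and> C y = 0 \<and> E (V y) = V y \<and> C (V y) = 0"
      if y: "\<And>w. w \<in> F \<Longrightarrow> cinner y w = 0" for y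
    proof -
      have fix_perp: "E x = x \<and> C x = 0" if "\<And>w. w \<in> F \<Longrightarrow> cinner x w = 0" for x
        using that by (simp add: E_eq C_eq diag_map_orthogonal)
      \<comment> \<open>Write \<open>w = V z\<close> with \<open>z\<close> in some
        \<open>KK i\<close>. The self-adjoint \<open>E\<close> fixes \<open>y\<close> and multiplies
        \<open>z\<close> by \<open>a i > 1\<close>, so \<open>y\<close> is orthogonal to
        \<open>z\<close>, hence \<open>V y\<close> to \<open>w\<close>.\<close>
      have "cinner (V y) w = 0" if w: "w \<in> F" for w
      proof -
        obtain i where i: "i \<in> {1..l}" "w \<in> KK i" using F_KK[OF w] by blast
        then obtain z where z: "z \<in> KK i" "w = V z" using R by blast
        have "cinner y z = cinner y (E z)"
          using adjE[of y z] fix_perp[OF y] by simp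
        also have "\<dots> = complex_of_real (a i) * cinner y z"
          using z KK_iff[OF i(1)] by (simp add: cinner_scaleC_right)
        finally have "cinner y z = 0"
          using a1[OF i(1)] by auto
        then show ?thesis by (simp add: z v_simps)
      qed
      then show ?thesis using fix_perp y by blast
    qed
    have "E (V x) = V (E x) \<and> C (V x) = U (C x)" for x
    proof -
      \<comment> \<open>Projecting onto the span of \<open>F\<close> splits \<open>x\<close> into a
        part covered by \<open>on_F\<close> and a residual covered by
        \<open>on_perp\<close>.\<close>
      define p where "p = diag_map F (\<lambda>_. 1) (\<lambda>v. v) (\<lambda>v. v) x"
      define y where "y = x - p"
      have y: "cinner y w = 0" if "w \<in> F" for w
        unfolding y_def p_def using orthonormal_residual[OF v that] by simp
      have p: "p \<in> cvs.span F"
        unfolding p_def diag_map_def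
        by (intro cvs.span_sum cvs.span_scale cvs.span_base)
      have "E (V p) = V (E p)" "C (V p) = U (C p)"
        using clinear_op_comp_eq_on_span[OF linE linV linV linE on_F(1) p]
          clinear_op_comp_eq_on_span[OF linC linV linU linC on_F(2) p] by auto
      moreover have "E (V y) = V (E y)" "C (V y) = U (C y)"
        using on_perp[OF y] clinear_op_zero[OF linU] by auto
      moreover have "x = y + p" by (simp add: y_def)
      ultimately show ?thesis
        by (simp add: linE[THEN clinear_op_add] linC[THEN clinear_op_add] linU[THEN clinear_op_add]
            linV[THEN clinear_op_add])
    qed
    then show "normal_op T \<and> \<not> unitary_op T"
      using normal_iff not_unitary by blast
  qed
qed

end
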